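(* Let $X=N_{\mathbb R}/\Lambda$ be a real torus. Every tropical line bundle on $X$ is isomorphic to $\mathcal L(E,l)$ for some symmetric bilinear form $E$ on $N_{\mathbb R}$ with $E(N,\Lambda)\subseteq\mathbb Z$ and some $l\in\operatorname{Hom}(N_{\mathbb R},\mathbb R)$. Moreover, two such pairs $(E,l)$ and $(E',l')$ define the same line bundle, i.e. $\mathcal L(E,l)\cong\mathcal L(E',l')$, if and only if $E=E'$ and $(l-l')(N)\subseteq\mathbb Z$.
   Context: A real torus is $X=N_{\mathbb R}/\Lambda$, where $N$ is a lattice (free abelian group of finite rank), $N_{\mathbb R}=N\otimes\mathbb R$, and $\Lambda\subset N_{\mathbb R}$ is a lattice of full rank (i.e. $\Lambda_{\mathbb R}\to N_{\mathbb R}$ is an isomorphism); in particular $\operatorname{Hom}(\Lambda,\mathbb R)=\operatorname{Hom}(N_{\mathbb R},\mathbb R)$. The sheaf $\mathrm{Aff}_X$ of integral affine functions consists of the continuous real functions whose pullback to $N_{\mathbb R}$ is locally of the form $x\mapsto\langle m,x\rangle+a$ with $m\in\operatorname{Hom}(N,\mathbb Z)$, $a\in\mathbb R$. A tropical line bundle on $X$ is an $\mathrm{Aff}_X$-torsor; equivalently, a map $Y\to X$ that is locally on $X$ isomorphic to $U\times\mathbb R\to U$, with transition maps between trivializations of the form $(u,b)\mapsto(u,b+\phi(u))$, $\phi$ an integral affine function. Isomorphism classes of tropical line bundles are in bijection with $H^1(X,\mathrm{Aff}_X)$. For a symmetric bilinear form $E$ on $N_{\mathbb R}$ with $E(\Lambda\times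 N)\subseteq\mathbb Z$ and a linear form $l$, put $$a_{E,l}(\lambda,x)=l(\lambda)-E(\lambda,x)-\tfrac12E(\lambda,\lambda)\qquad(\lambda\in\Lambda,\ x\in N_{\mathbb R}).$$ Then $\lambda.(x,b)=(x+\lambda,\,b+a_{E,l}(\lambda,x))$ defines an action of $\Lambda$ on the trivial bundle $N_{\mathbb R}\times\mathbb R$, and $\mathcal L(E,l)=(N_{\mathbb R}\times\mathbb R)/\Lambda$ is the corresponding tropical line bundle on $X$. *)

theory Defs
  imports "HOL-Analysis.Analysis"
begin

text \<open>A full-rank lattice in a finite-dimensional real vector space: the integral span of some
  real basis.  If \<open>N\<close> is such a lattice in \<open>'v\<close>, then \<open>'v\<close> is a model of the real vector space
  \<open>N \<otimes> \<real>\<close>; its norm only serves to provide the (unique) Hausdorff vector space topology.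
  The zero space is allowed, which would not be the case for the class \<open>euclidean_space\<close>.\<close>

definition full_lattice :: "'v::real_vector set \<Rightarrow> bool" where
  "full_lattice M \<longleftrightarrow>
     (\<exists>B. finite B \<and> independent B \<and> span B = UNIV \<and>
          M = range (\<lambda>c :: 'v \<Rightarrow> int. \<Sum>b\<in>B. of_int (c b) *\<^sub>R b))"

definition quotient_topology :: "'a topology \<Rightarrow> ('a \<Rightarrow> 'b) \<Rightarrow> 'b topology" where
  "quotient_topology T q =
     topology (\<lambda>U. U \<subseteq> q ` topspace T \<and> openin T {x \<in> topspace T. q x \<in> U})"

lemma openin_quotient_topology:
  "openin (quotient_topology T q) U \<longleftrightarrow>
     U \<subseteq> q ` topspace T \<and> openin T {x \<in> topspace T. q x \<in> U}"
proof -
  have "istopology (\<lambda>U. U \<subseteq> q ` topspace T \<and> openin T {x \<in> topspace T. q x \<in> U})"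
    unfolding istopology_def
  proof (intro conjI allI impI)
    fix S U
    assume S: "S \<subseteq> q ` topspace T \<and> openin T {x \<in> topspace T. q x \<in> S}"
      and U: "U \<subseteq> q ` topspace T \<and> openin T {x \<in> topspace T. q x \<in> U}"
    have eq: "{x \<in> topspace T. q x \<in> S \<inter> U} =
        {x \<in> topspace T. q x \<in> S} \<inter> {x \<in> topspace T. q x \<in> U}" by auto
    show "openin T {x \<in> topspace T. q x \<in> S \<inter> U}"
      unfolding eq using S U by (intro openin_Int) auto
    show "S \<inter> U \<subseteq> q ` topspace T" using S by auto
  next
    fix K
    assume K: "\<forall>S\<in>K. S \<subseteq> q ` topspace T \<and> openin T {x \<in> topspace T. q x \<in> S}"
    have eq: "{x \<in> topspace T. q x \<in> \<Union>K} = (\<Union>S\<in>K. {x \<in> topspace T. q x \<in> S})" by auto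
    show "openin T {x \<in> topspace T. q x \<in> \<Union>K}"
      unfolding eq using K by (intro openin_Union) auto
    show "\<Union>K \<subseteq> q ` topspace T" using K by auto
  qed
  then show ?thesis unfolding quotient_topology_def by (simp add: topology_inverse')
qed

lemma topspace_quotient_topology [simp]:
  "topspace (quotient_topology T q) = q ` topspace T"
proof
  show "topspace (quotient_topology T q) \<subseteq> q ` topspace T"
    using openin_quotient_topology[of T q] openin_topspace by blast
  have "{x \<in> topspace T. q x \<in> q ` topspace T} = topspace T" by auto
  then have "openin (quotient_topology T q) (q ` topspace T)"
    by (simp add: openin_quotient_topology)
  then show "q ` topspace T \<subseteq> topspace (quotient_topology T q)" by (rule openin_subset)
qed

lemma quotient_map_quotient_topology: "quotient_map T (quotient_topology T q) q"
  by (auto simp: quotient_map_def openin_quotient_topology)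

definition coset :: "'v::real_normed_vector set \<Rightarrow> 'v \<Rightarrow> 'v set" where
  "coset \<Lambda> x = (\<lambda>v. x + v) ` \<Lambda>"

definition torus :: "'v::real_normed_vector set \<Rightarrow> 'v set topology" where
  "torus \<Lambda> = quotient_topology euclidean (coset \<Lambda>)"

text \<open>\<open>Hom(N, \<int>)\<close>, each homomorphism being identified with its linear extension.\<close>

definition dual_lattice :: "'v::real_vector set \<Rightarrow> ('v \<Rightarrow> real) set" where
  "dual_lattice N = {m. linear m \<and> m ` N \<subseteq> \<int>}"

text \<open>The sections over an open set \<open>U\<close> of the sheaf of integral affine functions on the torus;
  values outside \<open>U\<close> are irrelevant.\<close>

definition aff_sections ::
  "'v::real_normed_vector set \<Rightarrow> 'v set \<Rightarrow> 'v set set \<Rightarrow> ('v set \<Rightarrow> real) set" where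
  "aff_sections N \<Lambda> U =
     {\<phi>. continuous_map (subtopology (torus \<Lambda>) U) euclideanreal \<phi> \<and>
          (\<forall>x. coset \<Lambda> x \<in> U \<longrightarrow>
             (\<exists>W m a. open W \<and> x \<in> W \<and> m \<in> dual_lattice N \<and>
                (\<forall>z\<in>W. coset \<Lambda> z \<in> U \<longrightarrow> \<phi> (coset \<Lambda> z) = m z + a)))}"

text \<open>A space over the torus together with an atlas.  An element \<open>(U, t)\<close> of the atlas stands for
  the local trivialization \<open>y \<mapsto> (proj y, t y)\<close> over \<open>U\<close>, so \<open>t\<close> is the fibre coordinate.
  The atlas need not be maximal.\<close>

record ('v, 'y) torus_bundle =
  tot :: "'y topology"
  proj :: "'y \<Rightarrow> 'v set"
  atlas :: "('v set set \<times> ('y \<Rightarrow> real)) set"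

definition over :: "('v, 'y) torus_bundle \<Rightarrow> 'v set set \<Rightarrow> 'y set" where
  "over L U = {y \<in> topspace (tot L). proj L y \<in> U}"

definition tropical_line_bundle ::
  "'v::real_normed_vector set \<Rightarrow> 'v set \<Rightarrow> ('v, 'y) torus_bundle \<Rightarrow> bool" where
  "tropical_line_bundle N \<Lambda> L \<longleftrightarrow>
     continuous_map (tot L) (torus \<Lambda>) (proj L) \<and>
     (\<Union>(U, t)\<in>atlas L. U) = topspace (torus \<Lambda>) \<and>
     (\<forall>(U, t)\<in>atlas L.
        openin (torus \<Lambda>) U \<and>
        homeomorphic_map (subtopology (tot L) (over L U))
          (prod_topology (subtopology (torus \<Lambda>) U) euclideanreal)
          (\<lambda>y. (proj L y, t y))) \<and>
     (\<forall>(U, t)\<in>atlas L. \<forall>(U', t')\<in>atlas L.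
        \<exists>\<phi>\<in>aff_sections N \<Lambda> (U \<inter> U').
          \<forall>y\<in>over L (U \<inter> U'). t' y = t y + \<phi> (proj L y))"

definition tropical_iso ::
  "'v::real_normed_vector set \<Rightarrow> 'v set \<Rightarrow> ('v, 'y) torus_bundle \<Rightarrow> ('v, 'z) torus_bundle \<Rightarrow>
     ('y \<Rightarrow> 'z) \<Rightarrow> bool" where
  "tropical_iso N \<Lambda> L L' f \<longleftrightarrow>
     homeomorphic_map (tot L) (tot L') f \<and>
     (\<forall>y\<in>topspace (tot L). proj L' (f y) = proj L y) \<and>
     (\<forall>(U, t)\<in>atlas L. \<forall>(U', t')\<in>atlas L'.
        \<exists>\<phi>\<in>aff_sections N \<Lambda> (U \<inter> U').
          \<forall>y\<in>over L (U \<inter> U'). t' (f y) = t y + \<phi> (proj L y))"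

definition tropical_isomorphic ::
  "'v::real_normed_vector set \<Rightarrow> 'v set \<Rightarrow> ('v, 'y) torus_bundle \<Rightarrow> ('v, 'z) torus_bundle \<Rightarrow>
     bool" where
  "tropical_isomorphic N \<Lambda> L L' \<longleftrightarrow> (\<exists>f. tropical_iso N \<Lambda> L L' f)"

definition integral_form ::
  "'v::real_vector set \<Rightarrow> 'v set \<Rightarrow> ('v \<Rightarrow> 'v \<Rightarrow> real) \<Rightarrow> bool" where
  "integral_form N \<Lambda> E \<longleftrightarrow>
     bilinear E \<and> (\<forall>x y. E x y = E y x) \<and> (\<forall>n\<in>N. \<forall>v\<in>\<Lambda>. E n v \<in> \<int>)"

definition factor :: "('v \<Rightarrow> 'v \<Rightarrow> real) \<Rightarrow> ('v \<Rightarrow> real) \<Rightarrow> 'v \<Rightarrow> 'v \<Rightarrow> real" where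
  "factor E l v x = l v - E v x - 1 / 2 * E v v"

definition act ::
  "('v::real_vector \<Rightarrow> 'v \<Rightarrow> real) \<Rightarrow> 'v \<Rightarrow> 'v \<times> real \<Rightarrow> 'v \<times> real" where
  "act a v = (\<lambda>(x, b). (x + v, b + a v x))"

definition orbit ::
  "'v::real_vector set \<Rightarrow> ('v \<Rightarrow> 'v \<Rightarrow> real) \<Rightarrow> 'v \<times> real \<Rightarrow> ('v \<times> real) set" where
  "orbit \<Lambda> a p = (\<lambda>v. act a v p) ` \<Lambda>"

definition fibre_coord :: "'v set \<Rightarrow> ('v \<times> real) set \<Rightarrow> real" where
  "fibre_coord W Q = (THE b. \<exists>x\<in>W. (x, b) \<in> Q)"

text \<open>The orbit space of the action on \<open>'v \<times> \<real>\<close>.  The first projection maps the orbit of \<open>(x, b)\<close>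
  onto the coset of \<open>x\<close>.  An open \<open>W\<close> that maps injectively to the torus gives a trivialization over
  its image: the orbit of \<open>(x, b)\<close> with \<open>x \<in> W\<close> has fibre coordinate \<open>b\<close>.\<close>

definition trop_L ::
  "'v::real_normed_vector set \<Rightarrow> ('v \<Rightarrow> 'v \<Rightarrow> real) \<Rightarrow> ('v \<Rightarrow> real) \<Rightarrow>
     ('v, ('v \<times> real) set) torus_bundle" where
  "trop_L \<Lambda> E l =
     \<lparr> tot = quotient_topology euclidean (orbit \<Lambda> (factor E l)),
       proj = image fst,
       atlas = {(coset \<Lambda> ` W, fibre_coord W) | W.
                  open W \<and> inj_on (coset \<Lambda>) W} \<rparr>"

text \<open>With this atlas \<open>trop_L \<Lambda> E l\<close> is indeed a tropical line bundle; this is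
  \<open>tropical_line_bundle_trop_L\<close> below, and the lemmas before it serve only to prove it.\<close>

lemma full_lattice_zero: "full_lattice M \<Longrightarrow> 0 \<in> M"
  by (auto simp: full_lattice_def intro!: range_eqI[where x="\<lambda>_. 0"])

lemma full_lattice_add: "full_lattice M \<Longrightarrow> x \<in> M \<Longrightarrow> y \<in> M \<Longrightarrow> x + y \<in> M"
proof -
  assume "full_lattice M" "x \<in> M" "y \<in> M"
  then obtain B c d where "M = range (\<lambda>c :: 'a \<Rightarrow> int. \<Sum>b\<in>B. of_int (c b) *\<^sub>R b)"
    "x = (\<Sum>b\<in>B. of_int (c b) *\<^sub>R b)" "y = (\<Sum>b\<in>B. of_int (d b) *\<^sub>R b)"
    unfolding full_lattice_def by blast
  then show ?thesis
    by (auto intro!: range_eqI[where x="\<lambda>b. c b + d b"] simp: algebra_simps sum.distrib)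
qed

lemma full_lattice_minus: "full_lattice M \<Longrightarrow> x \<in> M \<Longrightarrow> - x \<in> M"
proof -
  assume "full_lattice M" "x \<in> M"
  then obtain B c where "M = range (\<lambda>c :: 'a \<Rightarrow> int. \<Sum>b\<in>B. of_int (c b) *\<^sub>R b)"
    "x = (\<Sum>b\<in>B. of_int (c b) *\<^sub>R b)"
    unfolding full_lattice_def by blast
  then show ?thesis
    by (auto intro!: range_eqI[where x="\<lambda>b. - c b"] simp: sum_negf)
qed

lemma coeff_bound:
  fixes B :: "'v::real_normed_vector set"
  assumes "finite B" "independent B"
  shows "\<exists>C>0. \<forall>c. \<forall>b\<in>B. \<bar>c b\<bar> \<le> C * norm (\<Sum>b\<in>B. c b *\<^sub>R b)"
  using assms
proof (induction B rule: finite_induct)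
  case empty
  then show ?case by (intro exI[of _ 1]) auto
next
  case (insert a B)
  from insert.prems have iB: "independent B" and na: "a \<notin> span B"
    using insert.hyps by (auto simp: independent_insert)
  then obtain C where C: "C > 0" "\<And>c b. b\<in>B \<Longrightarrow> \<bar>c b\<bar> \<le> C * norm (\<Sum>b\<in>B. c b *\<^sub>R b)"
    using insert.IH by blast
  have "\<exists>d>0. \<forall>c. d \<le> norm (a - (\<Sum>b\<in>B. c b *\<^sub>R b))"
  proof (rule ccontr)
    assume neg: "\<not> ?thesis"
    have "\<exists>c. norm (a - (\<Sum>b\<in>B. c b *\<^sub>R b)) < inverse (real (Suc n))" for n
    proof -
      have "inverse (real (Suc n)) > 0" by simp
      with neg show ?thesis by (meson not_le)
    qed
    then obtain c where c: "\<And>n. norm (a - (\<Sum>b\<in>B. c n b *\<^sub>R b)) < inverse (real (Suc n))"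
      by metis
    have conv: "(\<lambda>n. \<Sum>b\<in>B. c n b *\<^sub>R b) \<longlonglongrightarrow> a"
    proof -
      have "(\<lambda>n. a - (\<Sum>b\<in>B. c n b *\<^sub>R b)) \<longlonglongrightarrow> 0"
        by (rule Lim_null_comparison[OF _ LIMSEQ_inverse_real_of_nat])
           (use c less_imp_le in \<open>auto intro!: always_eventually\<close>)
      then have "(\<lambda>n. a - (a - (\<Sum>b\<in>B. c n b *\<^sub>R b))) \<longlonglongrightarrow> a - 0"
        by (intro tendsto_intros)
      then show ?thesis by simp
    qed
    then have Cau: "Cauchy (\<lambda>n. \<Sum>b\<in>B. c n b *\<^sub>R b)" by (rule LIMSEQ_imp_Cauchy)
    have "Cauchy (\<lambda>n. c n b)" if "b \<in> B" for b
    proof (rule metric_CauchyI)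
      fix e :: real assume "e > 0"
      then have "e / C > 0" using C by simp
      from metric_CauchyD[OF Cau this] obtain M where
        M: "\<And>m n. m \<ge> M \<Longrightarrow> n \<ge> M \<Longrightarrow>
             dist (\<Sum>b\<in>B. c m b *\<^sub>R b) (\<Sum>b\<in>B. c n b *\<^sub>R b) < e / C" by blast
      have "dist (c m b) (c n b) < e" if "m \<ge> M" "n \<ge> M" for m n
      proof -
        have "\<bar>c m b - c n b\<bar> \<le> C * norm (\<Sum>b\<in>B. (c m b - c n b) *\<^sub>R b)"
          using C(2)[OF \<open>b\<in>B\<close>, of "\<lambda>b. c m b - c n b"] .
        also have "\<dots> = C * dist (\<Sum>b\<in>B. c m b *\<^sub>R b) (\<Sum>b\<in>B. c n b *\<^sub>R b)"
          by (simp add: dist_norm scaleR_left_diff_distrib sum_subtractf)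
        also have "\<dots> < C * (e / C)" using M[OF that] C(1) by (intro mult_strict_left_mono)
        finally show ?thesis using C(1) by (simp add: dist_real_def)
      qed
      then show "\<exists>M. \<forall>m\<ge>M. \<forall>n\<ge>M. dist (c m b) (c n b) < e" by blast
    qed
    then have "\<forall>b\<in>B. \<exists>L. (\<lambda>n. c n b) \<longlonglongrightarrow> L"
      using Cauchy_convergent convergent_def by metis
    then obtain L where "\<And>b. b\<in>B \<Longrightarrow> (\<lambda>n. c n b) \<longlonglongrightarrow> L b" by metis
    then have "(\<lambda>n. \<Sum>b\<in>B. c n b *\<^sub>R b) \<longlonglongrightarrow> (\<Sum>b\<in>B. L b *\<^sub>R b)"
      by (intro tendsto_intros) auto
    with conv have "a = (\<Sum>b\<in>B. L b *\<^sub>R b)" using LIMSEQ_unique by blast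
    also have "\<dots> \<in> span B" by (intro span_sum span_scale span_base)
    finally show False using na by simp
  qed
  then obtain d where d: "d > 0" "\<And>c. d \<le> norm (a - (\<Sum>b\<in>B. c b *\<^sub>R b))" by blast
  define D where "D = 1 / d + C * (1 + norm a / d)"
  have "D > 0" unfolding D_def using C d by (intro add_pos_nonneg) auto
  moreover have "\<bar>c b\<bar> \<le> D * norm (\<Sum>b\<in>insert a B. c b *\<^sub>R b)" if "b \<in> insert a B" for c b
  proof -
    define s where "s = (\<Sum>b\<in>B. c b *\<^sub>R b)"
    define x where "x = (\<Sum>b\<in>insert a B. c b *\<^sub>R b)"
    have x: "x = c a *\<^sub>R a + s" unfolding x_def s_def using insert.hyps by simp
    have ca: "\<bar>c a\<bar> \<le> norm x / d"
    proof (cases "c a = 0")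
      case False
      have "a - (\<Sum>b\<in>B. (- c b / c a) *\<^sub>R b) = (1 / c a) *\<^sub>R x"
        using False unfolding x s_def
        by (simp add: scaleR_right_distrib scaleR_sum_right sum_negf divide_inverse mult.commute)
      with d(2)[of "\<lambda>b. - c b / c a"] have "d \<le> norm ((1 / c a) *\<^sub>R x)" by metis
      then show ?thesis using False d(1) by (simp add: field_simps)
    qed (use d in auto)
    have "norm s \<le> norm x + \<bar>c a\<bar> * norm a"
      using norm_triangle_ineq4[of x "c a *\<^sub>R a"] by (simp add: x)
    also have "\<dots> \<le> norm x + norm x / d * norm a" using mult_right_mono[OF ca, of "norm a"] by simp
    finally have s: "norm s \<le> norm x * (1 + norm a / d)" by (simp add: algebra_simps)
    show ?thesis
    proof (cases "b = a")
      case True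
      have "norm x / d \<le> D * norm x"
        unfolding D_def using C(1) d(1) by (simp add: algebra_simps)
      then show ?thesis using ca True x_def by simp
    next
      case False
      then have "\<bar>c b\<bar> \<le> C * norm s" using that C(2)[of b c] s_def by simp
      also have "\<dots> \<le> C * (norm x * (1 + norm a / d))" using s C(1) by (simp add: mult_left_mono)
      also have "\<dots> \<le> D * norm x"
        unfolding D_def using C(1) d(1) by (simp add: algebra_simps)
      finally show ?thesis using x_def by simp
    qed
  qed
  ultimately show ?case by blast
qed

lemma full_lattice_linear_continuous:
  fixes f :: "'v::real_normed_vector \<Rightarrow> real" and M :: "'v set"
  assumes "full_lattice M" "linear f"
  shows "continuous_on UNIV f"
proof -
  obtain B :: "'v set" where B: "finite B" "independent B" "span B = UNIV"
    using assms(1) unfolding full_lattice_def by blast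
  obtain C where C: "C > 0" "\<And>c b. b\<in>B \<Longrightarrow> \<bar>c b\<bar> \<le> C * norm (\<Sum>b\<in>B. c b *\<^sub>R b)"
    using coeff_bound[OF B(1,2)] by blast
  have "norm (f x) \<le> norm x * (\<Sum>b\<in>B. C * \<bar>f b\<bar>)" for x
  proof -
    have "x \<in> span B" using B by simp
    then obtain c where x: "x = (\<Sum>b\<in>B. c b *\<^sub>R b)" using span_finite[OF B(1)] by auto
    have "f x = (\<Sum>b\<in>B. c b * f b)"
      unfolding x by (simp add: linear_sum[OF assms(2)] linear_scale[OF assms(2)])
    then have "norm (f x) \<le> (\<Sum>b\<in>B. \<bar>c b\<bar> * \<bar>f b\<bar>)"
      using sum_abs[of "\<lambda>b. c b * f b" B] by (simp add: abs_mult)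
    also have "\<dots> \<le> (\<Sum>b\<in>B. (C * norm x) * \<bar>f b\<bar>)"
      using C(2) x by (intro sum_mono mult_right_mono) auto
    finally show ?thesis by (simp add: sum_distrib_left mult_ac)
  qed
  then have "bounded_linear f"
    using assms(2) by (intro bounded_linear.intro bounded_linear_axioms.intro) auto
  then show ?thesis by (simp add: linear_continuous_on)
qed

lemma full_lattice_discrete:
  fixes M :: "'v::real_normed_vector set"
  assumes "full_lattice M"
  shows "\<exists>e>0. \<forall>v\<in>M. norm v < e \<longrightarrow> v = 0"
proof -
  obtain B :: "'v set" where B: "finite B" "independent B"
     "M = range (\<lambda>c :: 'v \<Rightarrow> int. \<Sum>b\<in>B. of_int (c b) *\<^sub>R b)"
    using assms(1) unfolding full_lattice_def by blast
  obtain C where C: "C > 0" "\<And>c b. b\<in>B \<Longrightarrow> \<bar>c b\<bar> \<le> C * norm (\<Sum>b\<in>B. c b *\<^sub>R b)"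
    using coeff_bound[OF B(1,2)] by blast
  have "v = 0" if "v \<in> M" "norm v < 1 / C" for v
  proof -
    from that B obtain c :: "'v \<Rightarrow> int" where v: "v = (\<Sum>b\<in>B. of_int (c b) *\<^sub>R b)" by auto
    have "c b = 0" if "b \<in> B" for b
    proof -
      have "\<bar>of_int (c b)\<bar> \<le> C * norm v" using C(2)[OF that, of "\<lambda>b. of_int (c b)"] v by simp
      also have "\<dots> < 1" using \<open>norm v < 1 / C\<close> C(1) by (simp add: field_simps)
      finally show ?thesis by linarith
    qed
    then show ?thesis using v by simp
  qed
  then show ?thesis using C(1) by (intro exI[of _ "1 / C"]) auto
qed

context
  fixes N \<Lambda> :: "'v::real_normed_vector set" and E :: "'v \<Rightarrow> 'v \<Rightarrow> real" and l :: "'v \<Rightarrow> real"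
  assumes lat: "full_lattice \<Lambda>" and E: "integral_form N \<Lambda> E" and l: "linear l"
begin

lemmas lattice_zero = full_lattice_zero[OF lat]
lemmas lattice_add = full_lattice_add[OF lat]
lemmas lattice_minus = full_lattice_minus[OF lat]

lemma lattice_diff: "x \<in> \<Lambda> \<Longrightarrow> y \<in> \<Lambda> \<Longrightarrow> x - y \<in> \<Lambda>"
  using lattice_add[OF _ lattice_minus, of x y] by simp

lemma coset_eq_iff: "coset \<Lambda> x = coset \<Lambda> y \<longleftrightarrow> y - x \<in> \<Lambda>"
proof
  assume "coset \<Lambda> x = coset \<Lambda> y"
  moreover have "y \<in> coset \<Lambda> y" unfolding coset_def using lattice_zero by force
  ultimately have "y \<in> coset \<Lambda> x" by simp
  then show "y - x \<in> \<Lambda>" unfolding coset_def by auto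
next
  assume *: "y - x \<in> \<Lambda>"
  have "y + v \<in> coset \<Lambda> x" if "v \<in> \<Lambda>" for v
    unfolding coset_def using lattice_add[OF * that] by (auto intro!: image_eqI[of _ _ "y - x + v"])
  moreover have "x + v \<in> coset \<Lambda> y" if "v \<in> \<Lambda>" for v
    unfolding coset_def using lattice_diff[OF that *] by (auto intro!: image_eqI[of _ _ "v - (y - x)"])
  ultimately show "coset \<Lambda> x = coset \<Lambda> y" unfolding coset_def by auto
qed

lemma openin_coset_image:
  assumes "open S" shows "openin (torus \<Lambda>) (coset \<Lambda> ` S)"
proof -
  have "{x. coset \<Lambda> x \<in> coset \<Lambda> ` S} = (\<Union>v\<in>\<Lambda>. (\<lambda>x. v + x) ` S)" (is "?L = ?R")
  proof
    show "?L \<subseteq> ?R"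
    proof
      fix x assume "x \<in> ?L"
      then obtain s where "s \<in> S" "coset \<Lambda> s = coset \<Lambda> x" by auto
      then show "x \<in> ?R" by (auto simp: coset_eq_iff intro!: bexI[of _ "x - s"] image_eqI[of _ _ s])
    qed
    show "?R \<subseteq> ?L"
    proof
      fix x assume "x \<in> ?R"
      then obtain v s where "v \<in> \<Lambda>" "s \<in> S" "x = v + s" by auto
      moreover from this have "coset \<Lambda> x = coset \<Lambda> s" by (simp add: coset_eq_iff lattice_minus)
      ultimately show "x \<in> ?L" by simp
    qed
  qed
  moreover have "open ?R" using assms by (intro open_UN ballI open_translation)
  ultimately show ?thesis unfolding torus_def openin_quotient_topology by auto
qed

lemma topspace_torus: "topspace (torus \<Lambda>) = range (coset \<Lambda>)"
  unfolding torus_def by simp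

lemma continuous_coset: "continuous_map euclidean (torus \<Lambda>) (coset \<Lambda>)"
  unfolding torus_def by (rule quotient_imp_continuous_map[OF quotient_map_quotient_topology])

lemma form_bilinear: "bilinear E" and form_sym: "E x y = E y x" and form_integral: "n \<in> N \<Longrightarrow> v \<in> \<Lambda> \<Longrightarrow> E n v \<in> \<int>"
  using E unfolding integral_form_def by auto

lemma form_linear: "linear (E v)"
  using form_bilinear unfolding bilinear_def by blast

lemma factor_zero: "factor E l 0 x = 0"
  unfolding factor_def using bilinear_lzero[OF form_bilinear] linear_0[OF l] by simp

lemma factor_cocycle: "factor E l (v + w) x = factor E l v (x + w) + factor E l w x"
  unfolding factor_def linear_add[OF l] bilinear_ladd[OF form_bilinear] bilinear_radd[OF form_bilinear]
  by (simp add: form_sym[of w v] algebra_simps)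

lemma act_act: "act (factor E l) v (act (factor E l) w p) = act (factor E l) (w + v) p"
  using factor_cocycle[of v w "fst p"] by (simp add: act_def case_prod_unfold add.commute add.left_commute)

lemma act_zero: "act (factor E l) 0 p = p"
  by (cases p) (simp add: act_def factor_zero)

lemma orbit_act:
  assumes "v \<in> \<Lambda>" shows "orbit \<Lambda> (factor E l) (act (factor E l) v p) = orbit \<Lambda> (factor E l) p"
proof -
  have "act (factor E l) w p \<in> orbit \<Lambda> (factor E l) (act (factor E l) v p)" if "w \<in> \<Lambda>" for w
    unfolding orbit_def using lattice_diff[OF that assms]
    by (auto simp: act_act intro!: image_eqI[of _ _ "w - v"])
  moreover have "act (factor E l) w (act (factor E l) v p) \<in> orbit \<Lambda> (factor E l) p" if "w \<in> \<Lambda>" for w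
    unfolding orbit_def using lattice_add[OF assms that] by (auto simp: act_act)
  ultimately show ?thesis by (auto simp: orbit_def)
qed

lemma orbit_self: "p \<in> orbit \<Lambda> (factor E l) p"
  unfolding orbit_def using lattice_zero act_zero[of p] by (metis image_eqI)

lemma orbit_eq_iff: "orbit \<Lambda> (factor E l) p = orbit \<Lambda> (factor E l) q \<longleftrightarrow> (\<exists>v\<in>\<Lambda>. q = act (factor E l) v p)"
proof
  assume "orbit \<Lambda> (factor E l) p = orbit \<Lambda> (factor E l) q"
  then show "\<exists>v\<in>\<Lambda>. q = act (factor E l) v p" using orbit_self[of q] by (auto simp: orbit_def)
qed (auto simp: orbit_act)

lemma fst_orbit: "fst ` orbit \<Lambda> (factor E l) (x, b) = coset \<Lambda> x"
  by (auto simp: orbit_def act_def coset_def image_image)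

lemma continuous_act: "continuous_on UNIV (act (factor E l) v)"
proof -
  have "continuous_on UNIV (\<lambda>p::'v \<times> real. E v (fst p))"
    by (rule continuous_on_compose2[OF full_lattice_linear_continuous[OF lat form_linear]
          continuous_on_fst[OF continuous_on_id]]) simp
  then show ?thesis
    unfolding act_def factor_def case_prod_unfold by (intro continuous_intros)
qed

lemma openin_orbit_image:
  assumes "open S" shows "openin (tot (trop_L \<Lambda> E l)) (orbit \<Lambda> (factor E l) ` S)"
proof -
  have "{p. orbit \<Lambda> (factor E l) p \<in> orbit \<Lambda> (factor E l) ` S} = (\<Union>v\<in>\<Lambda>. act (factor E l) v -` S)"
    unfolding image_iff orbit_eq_iff vimage_def by blast
  moreover have "open \<dots>"
    using continuous_act assms by (intro open_UN ballI open_vimage)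
  ultimately show ?thesis unfolding trop_L_def by (auto simp: openin_quotient_topology)
qed

lemma quotient_map_orbit: "quotient_map euclidean (tot (trop_L \<Lambda> E l)) (orbit \<Lambda> (factor E l))"
  unfolding trop_L_def by (simp add: quotient_map_quotient_topology)

lemma topspace_tot_trop_L: "topspace (tot (trop_L \<Lambda> E l)) = range (orbit \<Lambda> (factor E l))"
  unfolding trop_L_def by simp

lemma continuous_proj: "continuous_map (tot (trop_L \<Lambda> E l)) (torus \<Lambda>) (image fst)"
proof (rule continuous_compose_quotient_map[OF quotient_map_orbit])
  have "image fst \<circ> orbit \<Lambda> (factor E l) = coset \<Lambda> \<circ> fst" by (auto simp: fst_orbit)
  moreover have "continuous_map euclidean euclidean (fst :: 'v \<times> real \<Rightarrow> 'v)"
    by (simp add: continuous_on_fst)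
  ultimately show "continuous_map euclidean (torus \<Lambda>) (image fst \<circ> orbit \<Lambda> (factor E l))"
    using continuous_coset by (metis continuous_map_compose)
qed

lemma fibre_coord_orbit:
  assumes "inj_on (coset \<Lambda>) W" "x \<in> W"
  shows "fibre_coord W (orbit \<Lambda> (factor E l) (x, b)) = b"
  unfolding fibre_coord_def
proof (rule the_equality)
  show "\<exists>y\<in>W. (y, b) \<in> orbit \<Lambda> (factor E l) (x, b)" using assms orbit_self by blast
  fix c assume "\<exists>y\<in>W. (y, c) \<in> orbit \<Lambda> (factor E l) (x, b)"
  then obtain v where v: "v \<in> \<Lambda>" "x + v \<in> W" "c = b + factor E l v x"
    by (auto simp: orbit_def act_def)
  then have "coset \<Lambda> x = coset \<Lambda> (x + v)" by (simp add: coset_eq_iff)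
  then have "x = x + v" by (rule inj_onD[OF assms(1)]) (use assms(2) v(2) in auto)
  then have "v = 0" by simp
  then show "c = b" using v factor_zero by simp
qed

lemma orbit_move:
  assumes "coset \<Lambda> x = coset \<Lambda> y"
  shows "orbit \<Lambda> (factor E l) (x, b) = orbit \<Lambda> (factor E l) (y, b + factor E l (y - x) x)"
proof -
  have "(y, b + factor E l (y - x) x) = act (factor E l) (y - x) (x, b)" by (simp add: act_def)
  then show ?thesis using orbit_act[of "y - x" "(x, b)"] assms by (simp add: coset_eq_iff)
qed

lemma over_trop_L:
  "over (trop_L \<Lambda> E l) (coset \<Lambda> ` W) = orbit \<Lambda> (factor E l) ` (W \<times> UNIV)"
proof
  show "over (trop_L \<Lambda> E l) (coset \<Lambda> ` W) \<subseteq> orbit \<Lambda> (factor E l) ` (W \<times> UNIV)"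
  proof
    fix Q assume Q: "Q \<in> over (trop_L \<Lambda> E l) (coset \<Lambda> ` W)"
    then obtain x b where x: "Q = orbit \<Lambda> (factor E l) (x, b)" unfolding over_def topspace_tot_trop_L by auto
    with Q have "coset \<Lambda> x \<in> coset \<Lambda> ` W" by (auto simp: over_def trop_L_def fst_orbit)
    then obtain y where "y \<in> W" "coset \<Lambda> x = coset \<Lambda> y" by auto
    then show "Q \<in> orbit \<Lambda> (factor E l) ` (W \<times> UNIV)" unfolding x using orbit_move by blast
  qed
  show "orbit \<Lambda> (factor E l) ` (W \<times> UNIV) \<subseteq> over (trop_L \<Lambda> E l) (coset \<Lambda> ` W)"
    by (auto simp: over_def topspace_tot_trop_L) (auto simp: trop_L_def fst_orbit)
qed

lemma chart_homeo:
  assumes "open W" "inj_on (coset \<Lambda>) W"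
  shows "homeomorphic_map (subtopology (tot (trop_L \<Lambda> E l)) (over (trop_L \<Lambda> E l) (coset \<Lambda> ` W)))
     (prod_topology (subtopology (torus \<Lambda>) (coset \<Lambda> ` W)) euclideanreal)
     (\<lambda>Q. (fst ` Q, fibre_coord W Q))"
    (is "homeomorphic_map ?B ?C ?h")
proof -
  let ?A = "top_of_set (W \<times> (UNIV :: real set))"
  have q: "homeomorphic_map ?A ?B (orbit \<Lambda> (factor E l))"
  proof (rule bijective_open_imp_homeomorphic_map)
    show "continuous_map ?A ?B (orbit \<Lambda> (factor E l))"
      unfolding over_trop_L
      using quotient_imp_continuous_map[OF quotient_map_orbit]
      by (auto simp: continuous_map_in_subtopology continuous_map_from_subtopology)
    show "open_map ?A ?B (orbit \<Lambda> (factor E l))"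
      unfolding open_map_def
    proof (intro allI impI)
      fix S assume "openin ?A S"
      then have S: "open S" "S \<subseteq> W \<times> UNIV"
        using openin_open_eq[of "W \<times> (UNIV :: real set)"] assms(1) by (auto simp: open_Times)
      then show "openin ?B (orbit \<Lambda> (factor E l) ` S)"
        unfolding over_trop_L openin_subtopology using openin_orbit_image[OF S(1)] by blast
    qed
    show "orbit \<Lambda> (factor E l) ` topspace ?A = topspace ?B"
      by (auto simp: over_trop_L topspace_tot_trop_L)
    show "inj_on (orbit \<Lambda> (factor E l)) (topspace ?A)"
    proof (rule inj_onI)
      fix p q assume p: "p \<in> topspace ?A" "q \<in> topspace ?A" "orbit \<Lambda> (factor E l) p = orbit \<Lambda> (factor E l) q"
      then have "coset \<Lambda> (fst p) = coset \<Lambda> (fst q)" by (metis fst_orbit prod.collapse)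
      then have "fst p = fst q" using assms(2) p by (auto dest: inj_onD)
      moreover have "snd p = snd q"
        using fibre_coord_orbit[OF assms(2), of "fst p" "snd p"] fibre_coord_orbit[OF assms(2), of "fst q" "snd q"] p by auto
      ultimately show "p = q" by (rule prod_eqI)
    qed
  qed
  have g: "homeomorphic_map ?A ?C (\<lambda>p. (coset \<Lambda> (fst p), snd p))"
  proof -
    have "homeomorphic_map (top_of_set W) (subtopology (torus \<Lambda>) (coset \<Lambda> ` W)) (coset \<Lambda>)"
    proof (rule bijective_open_imp_homeomorphic_map)
      show "continuous_map (top_of_set W) (subtopology (torus \<Lambda>) (coset \<Lambda> ` W)) (coset \<Lambda>)"
        using continuous_coset
        by (auto simp: continuous_map_in_subtopology continuous_map_from_subtopology)
      show "open_map (top_of_set W) (subtopology (torus \<Lambda>) (coset \<Lambda> ` W)) (coset \<Lambda>)"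
        unfolding open_map_def
      proof (intro allI impI)
        fix S assume "openin (top_of_set W) S"
        then have S: "open S" "S \<subseteq> W" using openin_open_eq[of W] assms(1) by auto
        then show "openin (subtopology (torus \<Lambda>) (coset \<Lambda> ` W)) (coset \<Lambda> ` S)"
          unfolding openin_subtopology using openin_coset_image[OF S(1)] by blast
      qed
    qed (use assms in \<open>auto simp: topspace_torus\<close>)
    then obtain g where "homeomorphic_maps (top_of_set W) (subtopology (torus \<Lambda>) (coset \<Lambda> ` W)) (coset \<Lambda>) g"
      by (auto simp: homeomorphic_map_maps)
    then have "homeomorphic_maps (prod_topology (top_of_set W) euclideanreal) ?C
       (\<lambda>(x,y). (coset \<Lambda> x, id y)) (\<lambda>(x,y). (g x, id y))"
      by (subst homeomorphic_maps_prod) (auto simp: homeomorphic_maps_def)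
    moreover have "prod_topology (top_of_set W) euclideanreal = ?A"
      using prod_topology_subtopology(1)[of euclidean W euclideanreal] by simp
    ultimately show ?thesis
      by (simp add: homeomorphic_map_maps case_prod_unfold) blast
  qed
  obtain r where r: "homeomorphic_maps ?A ?B (orbit \<Lambda> (factor E l)) r" using q by (auto simp: homeomorphic_map_maps)
  then have "homeomorphic_map ?B ?A r" by (meson homeomorphic_maps_map)
  from homeomorphic_map_compose[OF this g] show ?thesis
  proof (rule homeomorphic_map_eq)
    fix Q assume Q: "Q \<in> topspace ?B"
    then obtain x b where x: "x \<in> W" "Q = orbit \<Lambda> (factor E l) (x, b)" by (auto simp: over_trop_L)
    then have "r Q = (x, b)" using r by (auto simp: homeomorphic_maps_def)
    then show "((\<lambda>p. (coset \<Lambda> (fst p), snd p)) \<circ> r) Q = ?h Q"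
      using x fibre_coord_orbit[OF assms(2)] by (simp add: fst_orbit)
  qed
qed

lemma locally_affine_imp_aff:
  assumes O: "openin (torus \<Lambda>) U"
    and aff: "\<And>x. coset \<Lambda> x \<in> U \<Longrightarrow> \<exists>W m a. open W \<and> x \<in> W \<and> m \<in> dual_lattice N \<and>
                (\<forall>z\<in>W. coset \<Lambda> z \<in> U \<longrightarrow> \<phi> (coset \<Lambda> z) = m z + a)"
  shows "\<phi> \<in> aff_sections N \<Lambda> U"
proof -
  have U: "open {x. coset \<Lambda> x \<in> U}"
    using O by (simp add: torus_def openin_quotient_topology)
  have "continuous_map (subtopology (torus \<Lambda>) U) euclideanreal \<phi>"
    unfolding continuous_map_def
  proof (intro conjI allI impI)
    fix S :: "real set" assume "openin euclideanreal S"
    then have S: "open S" by simp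
    have "open {x. coset \<Lambda> x \<in> U \<and> \<phi> (coset \<Lambda> x) \<in> S}"
    proof (subst open_subopen, intro ballI)
      fix x assume "x \<in> {x. coset \<Lambda> x \<in> U \<and> \<phi> (coset \<Lambda> x) \<in> S}"
      then have x: "coset \<Lambda> x \<in> U" "\<phi> (coset \<Lambda> x) \<in> S" by auto
      from aff[OF x(1)] obtain W m c where W: "open W" "x \<in> W" "m \<in> dual_lattice N"
        "\<And>z. z \<in> W \<Longrightarrow> coset \<Lambda> z \<in> U \<Longrightarrow> \<phi> (coset \<Lambda> z) = m z + c" by blast
      have "continuous_on UNIV (\<lambda>z. m z + c)"
        using full_lattice_linear_continuous[OF lat] W(3)
        by (intro continuous_intros) (auto simp: dual_lattice_def)
      then have "open ((\<lambda>z. m z + c) -` S)" using S by (simp add: open_vimage)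
      then have "open (W \<inter> {x. coset \<Lambda> x \<in> U} \<inter> (\<lambda>z. m z + c) -` S)" using W U by auto
      then show "\<exists>T. open T \<and> x \<in> T \<and> T \<subseteq> {x. coset \<Lambda> x \<in> U \<and> \<phi> (coset \<Lambda> x) \<in> S}"
        using W x by (intro exI[of _ "W \<inter> {x. coset \<Lambda> x \<in> U} \<inter> (\<lambda>z. m z + c) -` S"]) auto
    qed
    moreover have "U \<subseteq> topspace (torus \<Lambda>)" using O by (rule openin_subset)
    ultimately have "openin (torus \<Lambda>) {c \<in> U. \<phi> c \<in> S}"
      by (auto simp: torus_def openin_quotient_topology)
    then show "openin (subtopology (torus \<Lambda>) U) {x \<in> topspace (subtopology (torus \<Lambda>) U). \<phi> x \<in> S}"
      using \<open>U \<subseteq> _\<close> by (auto simp: openin_subtopology intro!: exI[of _ "{c \<in> U. \<phi> c \<in> S}"])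
  qed auto
  then show ?thesis using aff unfolding aff_sections_def by blast
qed

lemma factor_dual: "v \<in> \<Lambda> \<Longrightarrow> (\<lambda>z. - E v z) \<in> dual_lattice N"
  using linear_compose_neg[OF form_linear[of v]] form_integral[of _ v] form_sym[of _ v] unfolding dual_lattice_def
  by (auto simp del: form_sym simp: image_subset_iff)

lemma chart_transition:
  assumes W: "open W" "inj_on (coset \<Lambda>) W" "open W'" "inj_on (coset \<Lambda>) W'"
  shows "\<exists>\<phi>\<in>aff_sections N \<Lambda> (coset \<Lambda> ` W \<inter> coset \<Lambda> ` W').
     \<forall>Q\<in>over (trop_L \<Lambda> E l) (coset \<Lambda> ` W \<inter> coset \<Lambda> ` W'). fibre_coord W' Q = fibre_coord W Q + \<phi> (fst ` Q)"
proof -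
  define s where "s = inv_into W (coset \<Lambda>)"
  define s' where "s' = inv_into W' (coset \<Lambda>)"
  have s: "s (coset \<Lambda> x) = x" if "x \<in> W" for x unfolding s_def using W that by simp
  have s': "s' (coset \<Lambda> x) = x" if "x \<in> W'" for x unfolding s'_def using W that by simp
  define \<phi> where "\<phi> c = factor E l (s' c - s c) (s c)" for c
  show ?thesis
  proof (intro bexI ballI)
    show "\<phi> \<in> aff_sections N \<Lambda> (coset \<Lambda> ` W \<inter> coset \<Lambda> ` W')"
    proof (rule locally_affine_imp_aff)
      show "openin (torus \<Lambda>) (coset \<Lambda> ` W \<inter> coset \<Lambda> ` W')"
        using W by (intro openin_Int openin_coset_image)
      fix x assume "coset \<Lambda> x \<in> coset \<Lambda> ` W \<inter> coset \<Lambda> ` W'"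
      then obtain y y' where y: "y \<in> W" "y' \<in> W'" "coset \<Lambda> x = coset \<Lambda> y" "coset \<Lambda> x = coset \<Lambda> y'"
        by auto
      define w where "w = y - x"
      define w' where "w' = y' - x"
      have w: "w \<in> \<Lambda>" "w' \<in> \<Lambda>" using y(3,4) unfolding w_def w'_def coset_eq_iff by auto
      let ?T = "{z. z + w \<in> W} \<inter> {z. z + w' \<in> W'}"
      have "open ((\<lambda>z. z + w) -` W \<inter> (\<lambda>z. z + w') -` W')"
        using W by (intro open_Int open_vimage continuous_intros)
      then have "open ?T" by (simp add: vimage_def)
      moreover have "x \<in> ?T" using y by (simp add: w_def w'_def)
      moreover have "\<phi> (coset \<Lambda> z) = - E (w' - w) z + (factor E l (w' - w) w)" if "z \<in> ?T" for z
      proof -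
        have "coset \<Lambda> z = coset \<Lambda> (z + w)" "coset \<Lambda> z = coset \<Lambda> (z + w')"
          using w by (simp_all add: coset_eq_iff)
        then have "s (coset \<Lambda> z) = z + w" "s' (coset \<Lambda> z) = z + w'"
          using that s[of "z + w"] s'[of "z + w'"] by auto
        then have "\<phi> (coset \<Lambda> z) = factor E l (w' - w) (z + w)" unfolding \<phi>_def by simp
        then show ?thesis by (simp add: factor_def linear_add[OF form_linear])
      qed
      ultimately show "\<exists>T m b. open T \<and> x \<in> T \<and> m \<in> dual_lattice N \<and>
          (\<forall>z\<in>T. coset \<Lambda> z \<in> coset \<Lambda> ` W \<inter> coset \<Lambda> ` W' \<longrightarrow> \<phi> (coset \<Lambda> z) = m z + b)"
        using factor_dual[OF lattice_diff[OF w(2) w(1)]]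
        by (intro exI[of _ ?T] exI[of _ "\<lambda>z. - E (w' - w) z"] exI[of _ "factor E l (w' - w) w"]) auto
    qed
    fix Q assume "Q \<in> over (trop_L \<Lambda> E l) (coset \<Lambda> ` W \<inter> coset \<Lambda> ` W')"
    then have Q: "Q \<in> over (trop_L \<Lambda> E l) (coset \<Lambda> ` W)" "fst ` Q \<in> coset \<Lambda> ` W'"
      by (auto simp: over_def trop_L_def)
    then obtain x b where x: "x \<in> W" "Q = orbit \<Lambda> (factor E l) (x, b)" by (auto simp: over_trop_L)
    with Q obtain y where y: "y \<in> W'" "coset \<Lambda> x = coset \<Lambda> y" by (auto simp: fst_orbit)
    have "fibre_coord W' Q = b + factor E l (y - x) x"
      unfolding x orbit_move[OF y(2)] using fibre_coord_orbit[OF W(4) y(1)] .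
    moreover have "fibre_coord W Q = b" unfolding x using fibre_coord_orbit[OF W(2) x(1)] .
    moreover have "\<phi> (fst ` Q) = factor E l (y - x) x"
      unfolding x fst_orbit \<phi>_def s[OF x(1)] using s'[OF y(1)] y(2) by simp
    ultimately show "fibre_coord W' Q = fibre_coord W Q + \<phi> (fst ` Q)" by simp
  qed
qed

lemma chart_cover: "\<exists>W. open W \<and> inj_on (coset \<Lambda>) W \<and> x \<in> W"
proof -
  obtain e where e: "e > 0" "\<And>v. v \<in> \<Lambda> \<Longrightarrow> norm v < e \<Longrightarrow> v = 0"
    using full_lattice_discrete[OF lat] by blast
  have "inj_on (coset \<Lambda>) (ball x (e / 2))"
  proof (rule inj_onI)
    fix y z assume *: "y \<in> ball x (e / 2)" "z \<in> ball x (e / 2)" "coset \<Lambda> y = coset \<Lambda> z"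
    then have "dist z y < e" by (metis dist_commute dist_triangle_half_r mem_ball)
    then show "y = z" using * e(2)[of "z - y"] by (simp add: coset_eq_iff dist_norm)
  qed
  then show ?thesis using e(1) by (intro exI[of _ "ball x (e/2)"]) auto
qed

lemma tropical_line_bundle_trop_L: "tropical_line_bundle N \<Lambda> (trop_L \<Lambda> E l)"
proof -
  have pr: "proj (trop_L \<Lambda> E l) = image fst" by (simp add: trop_L_def)
  have at: "atlas (trop_L \<Lambda> E l) =
      {(coset \<Lambda> ` W, fibre_coord W) | W. open W \<and> inj_on (coset \<Lambda>) W}"
    by (simp add: trop_L_def)
  have "(\<Union>(U, t)\<in>atlas (trop_L \<Lambda> E l). U) = topspace (torus \<Lambda>)"
  proof
    show "(\<Union>(U, t)\<in>atlas (trop_L \<Lambda> E l). U) \<subseteq> topspace (torus \<Lambda>)"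
      by (auto simp: at topspace_torus)
    show "topspace (torus \<Lambda>) \<subseteq> (\<Union>(U, t)\<in>atlas (trop_L \<Lambda> E l). U)"
    proof
      fix c assume "c \<in> topspace (torus \<Lambda>)"
      then obtain x where x: "c = coset \<Lambda> x" by (auto simp: topspace_torus)
      obtain W where W: "open W" "inj_on (coset \<Lambda>) W" "x \<in> W" using chart_cover by blast
      then have "(coset \<Lambda> ` W, fibre_coord W) \<in> atlas (trop_L \<Lambda> E l)" unfolding at by blast
      then show "c \<in> (\<Union>(U, t)\<in>atlas (trop_L \<Lambda> E l). U)"
        by (rule UN_I) (use W(3) x in auto)
    qed
  qed
  then show ?thesis
    unfolding tropical_line_bundle_def pr
    
  proof (intro conjI)
    show "\<forall>(U, t)\<in>atlas (trop_L \<Lambda> E l). openin (torus \<Lambda>) U \<and>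
        homeomorphic_map (subtopology (tot (trop_L \<Lambda> E l)) (over (trop_L \<Lambda> E l) U))
          (prod_topology (subtopology (torus \<Lambda>) U) euclideanreal) (\<lambda>y. (fst ` y, t y))"
    proof clarify
      fix U t assume "(U, t) \<in> atlas (trop_L \<Lambda> E l)"
      then obtain W where W: "U = coset \<Lambda> ` W" "t = fibre_coord W" "open W" "inj_on (coset \<Lambda>) W"
        unfolding at by auto
      show "openin (torus \<Lambda>) U \<and>
        homeomorphic_map (subtopology (tot (trop_L \<Lambda> E l)) (over (trop_L \<Lambda> E l) U))
          (prod_topology (subtopology (torus \<Lambda>) U) euclideanreal) (\<lambda>y. (fst ` y, t y))"
        unfolding W(1,2) using chart_homeo[OF W(3,4)] openin_coset_image[OF W(3)] by (rule conjI[rotated])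
    qed
    show "\<forall>(U, t)\<in>atlas (trop_L \<Lambda> E l). \<forall>(U', t')\<in>atlas (trop_L \<Lambda> E l).
        \<exists>\<phi>\<in>aff_sections N \<Lambda> (U \<inter> U').
          \<forall>y\<in>over (trop_L \<Lambda> E l) (U \<inter> U'). t' y = t y + \<phi> (fst ` y)"
    proof clarify
      fix U t U' t' assume "(U, t) \<in> atlas (trop_L \<Lambda> E l)" "(U', t') \<in> atlas (trop_L \<Lambda> E l)"
      then obtain W W' where W: "U = coset \<Lambda> ` W" "t = fibre_coord W" "open W" "inj_on (coset \<Lambda>) W"
        "U' = coset \<Lambda> ` W'" "t' = fibre_coord W'" "open W'" "inj_on (coset \<Lambda>) W'"
        unfolding at by auto
      show "\<exists>\<phi>\<in>aff_sections N \<Lambda> (U \<inter> U').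
          \<forall>y\<in>over (trop_L \<Lambda> E l) (U \<inter> U'). t' y = t y + \<phi> (fst ` y)"
        unfolding W(1,2,5,6) using chart_transition[OF W(3,4,7,8)] .
    qed
  qed (rule continuous_proj)
qed

end

end

theory Submission
  imports Defs
begin

text \<open>A line bundle on the torus pulls back to a bundle on the universal cover \<open>N\<^sub>\<real>\<close>, whose
  transition functions form a cocycle of locally integral affine functions.  Such a cocycle splits:
  an affine function is determined by its germ, so splittings over two open boxes with a connected
  intersection can be glued, and subdividing one coordinate at a time reduces large boxes to boxes
  inside a single chart.  A splitting \<open>g\<close> turns the action of \<open>\<Lambda>\<close> into an automorphy factor
  \<open>g x - g (x + v) = m\<^sub>v x + c\<^sub>v\<close>.  The cocycle condition makes \<open>m\<close> additive and
  \<open>m\<^sub>v w = m\<^sub>w v\<close>, so that \<open>- m\<close> extends to the form \<open>E\<close>, and it makes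
  \<open>c\<^sub>v + E v v / 2\<close> additive, which yields \<open>l\<close>.  Conversely, an isomorphism between two of
  the bundles \<open>trop_L\<close> is the translation of fibres by a globally affine function \<open>m x + a\<close>,
  whose effect on automorphy factors is to add the restriction of \<open>m\<close> to \<open>l\<close>.\<close>

section \<open>Germs of integral affine functions and splittings of cocycles\<close>

lemma dual_lattice_zero: "(\<lambda>_. 0) \<in> dual_lattice N"
  by (auto simp: dual_lattice_def module_hom_zero)

lemma dual_lattice_add: "m \<in> dual_lattice N \<Longrightarrow> m' \<in> dual_lattice N \<Longrightarrow> (\<lambda>x. m x + m' x) \<in> dual_lattice N"
  by (auto simp: dual_lattice_def linear_compose_add image_subset_iff)

lemma dual_lattice_minus: "m \<in> dual_lattice N \<Longrightarrow> (\<lambda>x. - m x) \<in> dual_lattice N"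
  by (auto simp: dual_lattice_def linear_compose_neg image_subset_iff)

lemma dual_lattice_linear: "m \<in> dual_lattice N \<Longrightarrow> linear m"
  by (simp add: dual_lattice_def)

text \<open>Every direction \<open>v\<close> can be reached by a small step
  \<open>t *\<^sub>R v\<close> from \<open>x\<close>. Comparing the two functions there and at
  \<open>x\<close> gives equal slopes along \<open>v\<close>, and then equal constants.\<close>

lemma affine_germ_unique:
  fixes m m' :: "'v::real_normed_vector \<Rightarrow> real"
  assumes "linear m" "linear m'" and ev: "\<forall>\<^sub>F z in nhds x. m z + a = m' z + a'"
  shows "m = m' \<and> a = a'"
proof -
  obtain e where e: "e > 0" "\<And>z. dist z x < e \<Longrightarrow> m z + a = m' z + a'"
    using ev unfolding eventually_nhds_metric by blast
  have x: "m x + a = m' x + a'" using e by simp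
  have "m v = m' v" for v
  proof -
    \<comment> \<open>Adding 1 keeps the denominator positive for \<open>v = 0\<close>; the factor 2
      leaves the step strictly inside the ball of radius \<open>e\<close>.\<close>
    define t where "t = e / (2 * (norm v + 1))"
    have t: "t > 0" unfolding t_def using e(1) by (simp add: add_nonneg_pos)
    have "t * norm v < e"
    proof -
      have "t * norm v \<le> t * (norm v + 1)" using t by simp
      also have "\<dots> = e / 2" unfolding t_def using norm_ge_zero[of v] by (simp add: divide_simps add_nonneg_eq_0_iff)
      finally show ?thesis using e(1) by simp
    qed
    then have "m (x + t *\<^sub>R v) + a = m' (x + t *\<^sub>R v) + a'"
      using e(2)[of "x + t *\<^sub>R v"] t by (simp add: dist_norm)
    then have "m x + t * m v + a = m' x + t * m' v + a'"
      by (simp add: linear_add linear_scale assms(1,2))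
    then have "t * m v = t * m' v" using x by linarith
    then show ?thesis using t by simp
  qed
  then show ?thesis using x by auto
qed

text \<open>The local condition of \<open>aff_sections\<close>, phrased with a filter on the
  universal cover, so that germs can be added, negated and translated without tracking
  neighbourhoods.\<close>

definition affine_near :: "'v::real_normed_vector set \<Rightarrow> ('v \<Rightarrow> real) \<Rightarrow> 'v \<Rightarrow> bool" where
  "affine_near N f x \<longleftrightarrow> (\<exists>m\<in>dual_lattice N. \<exists>a. \<forall>\<^sub>F z in nhds x. f z = m z + a)"

lemma affine_nearI:
  "m \<in> dual_lattice N \<Longrightarrow> \<forall>\<^sub>F z in nhds x. f z = m z + a \<Longrightarrow> affine_near N f x"
  unfolding affine_near_def by blast

lemma affine_nearE:
  assumes "affine_near N f x"
  obtains m a where "m \<in> dual_lattice N" "\<forall>\<^sub>F z in nhds x. f z = m z + a"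
  using assms unfolding affine_near_def by blast

lemma affine_near_affine: "m \<in> dual_lattice N \<Longrightarrow> affine_near N (\<lambda>z. m z + a) x"
  by (rule affine_nearI[where m=m and a=a]) simp_all

lemma affine_near_add:
  assumes "affine_near N f x" "affine_near N g x"
  shows "affine_near N (\<lambda>z. f z + g z) x"
proof -
  obtain m a where m: "m \<in> dual_lattice N" "\<forall>\<^sub>F z in nhds x. f z = m z + a"
    by (rule affine_nearE[OF assms(1)])
  obtain m' a' where m': "m' \<in> dual_lattice N" "\<forall>\<^sub>F z in nhds x. g z = m' z + a'"
    by (rule affine_nearE[OF assms(2)])
  from m(2) m'(2) have "\<forall>\<^sub>F z in nhds x. f z + g z = m z + m' z + (a + a')"
    by eventually_elim simp
  then show ?thesis by (rule affine_nearI[OF dual_lattice_add[OF m(1) m'(1)]])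
qed

lemma affine_near_minus:
  assumes "affine_near N f x"
  shows "affine_near N (\<lambda>z. - f z) x"
proof -
  obtain m a where m: "m \<in> dual_lattice N" "\<forall>\<^sub>F z in nhds x. f z = m z + a"
    by (rule affine_nearE[OF assms])
  from m(2) have "\<forall>\<^sub>F z in nhds x. - f z = - m z + - a" by eventually_elim simp
  then show ?thesis by (rule affine_nearI[OF dual_lattice_minus[OF m(1)]])
qed

lemma affine_near_diff:
  "affine_near N f x \<Longrightarrow> affine_near N g x \<Longrightarrow> affine_near N (\<lambda>z. f z - g z) x"
  unfolding diff_conv_add_uminus by (intro affine_near_add affine_near_minus)

lemma affine_near_eventually_cong:
  assumes "affine_near N f x" "\<forall>\<^sub>F z in nhds x. g z = f z"
  shows "affine_near N g x"
proof -
  obtain m a where m: "m \<in> dual_lattice N" "\<forall>\<^sub>F z in nhds x. f z = m z + a"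
    by (rule affine_nearE[OF assms(1)])
  from m(2) assms(2) have "\<forall>\<^sub>F z in nhds x. g z = m z + a" by eventually_elim simp
  then show ?thesis by (rule affine_nearI[OF m(1)])
qed

lemma affine_near_cong_open:
  assumes "affine_near N f x" "open W" "x \<in> W" "\<And>z. z \<in> W \<Longrightarrow> g z = f z"
  shows "affine_near N g x"
proof (rule affine_near_eventually_cong[OF assms(1)])
  show "\<forall>\<^sub>F z in nhds x. g z = f z"
    by (rule eventually_mono[OF eventually_nhds_in_open[OF assms(2,3)]]) (rule assms(4))
qed

lemma affine_near_translate:
  assumes "affine_near N f (x + v)"
  shows "affine_near N (\<lambda>z. f (z + v)) x"
proof -
  obtain m a where m: "m \<in> dual_lattice N" "\<forall>\<^sub>F z in nhds (x + v). f z = m z + a"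
    by (rule affine_nearE[OF assms])
  have "((\<lambda>z. z + v) \<longlongrightarrow> x + v) (nhds x)" by (intro tendsto_intros filterlim_ident)
  with m(2) have "\<forall>\<^sub>F z in nhds x. f (z + v) = m (z + v) + a"
    by (rule eventually_compose_filterlim)
  then have "\<forall>\<^sub>F z in nhds x. f (z + v) = m z + (m v + a)"
    by eventually_elim (simp add: linear_add[OF dual_lattice_linear[OF m(1)]])
  then show ?thesis by (rule affine_nearI[OF m(1)])
qed

text \<open>By uniqueness of affine germs, the slope and constant found at a point persist at all
  nearby points. They are locally constant, hence constant on a connected set.\<close>

lemma affine_near_imp_affine:
  assumes "connected W" "open W" and aff: "\<And>x. x \<in> W \<Longrightarrow> affine_near N f x"
  shows "\<exists>m\<in>dual_lattice N. \<exists>a. \<forall>z\<in>W. f z = m z + a"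
proof (cases "W = {}")
  case True
  then show ?thesis using dual_lattice_zero by auto
next
  case False
  \<comment> \<open>Slope and constant are packed into one pair, so that a single function
    \<open>p\<close> is shown to be locally constant.\<close>
  have "\<forall>x\<in>W. \<exists>p. fst p \<in> dual_lattice N \<and> (\<forall>\<^sub>F z in nhds x. f z = fst p z + snd p)"
  proof
    fix x assume "x \<in> W"
    then obtain m a where m: "m \<in> dual_lattice N" "\<forall>\<^sub>F z in nhds x. f z = m z + a"
      by (rule affine_nearE[OF aff])
    then show "\<exists>p. fst p \<in> dual_lattice N \<and> (\<forall>\<^sub>F z in nhds x. f z = fst p z + snd p)"
      by (intro exI[of _ "(m, a)"]) simp
  qed
  from bchoice[OF this] obtain p where
    "\<forall>x\<in>W. fst (p x) \<in> dual_lattice N \<and> (\<forall>\<^sub>F z in nhds x. f z = fst (p x) z + snd (p x))"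
    by (rule exE)
  then have p: "fst (p x) \<in> dual_lattice N"
    and ev: "\<forall>\<^sub>F z in nhds x. f z = fst (p x) z + snd (p x)" if "x \<in> W" for x
    using that by auto
  have "p constant_on W"
  proof (rule locally_constant_imp_constant[OF assms(1)])
    fix x assume x: "x \<in> W"
    obtain T where T: "open T" "x \<in> T" "\<forall>z\<in>T. f z = fst (p x) z + snd (p x)"
      using ev[OF x] unfolding eventually_nhds by blast
    have "p y = p x" if y: "y \<in> W \<inter> T" for y
    proof -
      have "\<forall>\<^sub>F z in nhds y. f z = fst (p x) z + snd (p x)"
        by (rule eventually_mono[OF eventually_nhds_in_open[OF T(1)]]) (use T y in auto)
      moreover have "\<forall>\<^sub>F z in nhds y. f z = fst (p y) z + snd (p y)" using y by (intro ev) auto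
      ultimately have "\<forall>\<^sub>F z in nhds y. fst (p y) z + snd (p y) = fst (p x) z + snd (p x)"
        by eventually_elim simp
      moreover have "linear (fst (p y))" "linear (fst (p x))"
        using p[of x] p[of y] x y by (auto intro: dual_lattice_linear)
      ultimately have "fst (p y) = fst (p x) \<and> snd (p y) = snd (p x)"
        by (intro affine_germ_unique)
      then show ?thesis by (simp add: prod_eq_iff)
    qed
    then show "\<exists>T. openin (top_of_set W) T \<and> x \<in> T \<and> (\<forall>y\<in>T. p y = p x)"
      using openin_open_Int[OF T(1), of W] T(2) x by blast
  qed
  then obtain q where q: "\<And>x. x \<in> W \<Longrightarrow> p x = q" by (auto simp: constant_on_def)
  have "f z = fst q z + snd q" if "z \<in> W" for z
    using eventually_nhds_x_imp_x[OF ev[OF that]] q[OF that] by simp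
  moreover have "fst q \<in> dual_lattice N"
  proof -
    obtain x where "x \<in> W" using False by blast
    then show ?thesis using p[of x] q[of x] by simp
  qed
  ultimately show ?thesis by (intro bexI[of _ "fst q"] exI[of _ "snd q"] ballI)
qed

section \<open>Cocycles of affine functions: uniqueness and gluing of splittings\<close>

locale affine_cocycle =
  fixes N :: "'v::real_normed_vector set" and I :: "'i set" and U :: "'i \<Rightarrow> 'v set"
    and \<phi> :: "'i \<Rightarrow> 'i \<Rightarrow> 'v \<Rightarrow> real"
  assumes open_U: "i \<in> I \<Longrightarrow> open (U i)"
    and cover_U: "\<exists>i\<in>I. x \<in> U i"
    and cocycle: "i \<in> I \<Longrightarrow> j \<in> I \<Longrightarrow> k \<in> I \<Longrightarrow> x \<in> U i \<Longrightarrow> x \<in> U j \<Longrightarrow> x \<in> U k \<Longrightarrow>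
       \<phi> i k x = \<phi> i j x + \<phi> j k x"
    and affine_\<phi>: "i \<in> I \<Longrightarrow> j \<in> I \<Longrightarrow> x \<in> U i \<Longrightarrow> x \<in> U j \<Longrightarrow> affine_near N (\<phi> i j) x"
begin

text \<open>A 0-cochain of affine functions with coboundary \<open>\<phi>\<close>, that is, a
  trivialization over \<open>W\<close> of the torsor glued by \<open>\<phi>\<close>.\<close>

definition splits_on :: "'v set \<Rightarrow> ('i \<Rightarrow> 'v \<Rightarrow> real) \<Rightarrow> bool" where
  "splits_on W g \<longleftrightarrow> (\<forall>x\<in>W.
     (\<forall>i\<in>I. x \<in> U i \<longrightarrow> affine_near N (g i) x) \<and>
     (\<forall>i\<in>I. \<forall>j\<in>I. x \<in> U i \<longrightarrow> x \<in> U j \<longrightarrow> g j x = g i x + \<phi> i j x))"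

lemma splits_onD:
  "splits_on W g \<Longrightarrow> x \<in> W \<Longrightarrow> i \<in> I \<Longrightarrow> j \<in> I \<Longrightarrow> x \<in> U i \<Longrightarrow> x \<in> U j \<Longrightarrow> g j x = g i x + \<phi> i j x"
  unfolding splits_on_def by blast

lemma splits_on_affine: "splits_on W g \<Longrightarrow> x \<in> W \<Longrightarrow> i \<in> I \<Longrightarrow> x \<in> U i \<Longrightarrow> affine_near N (g i) x"
  unfolding splits_on_def by blast

lemma splits_on_mono: "splits_on W g \<Longrightarrow> V \<subseteq> W \<Longrightarrow> splits_on V g"
  unfolding splits_on_def by blast

text \<open>Inside a single member of the cover, the row \<open>\<phi> i\<close> is itself a
  splitting: the splitting equation becomes the cocycle identity.\<close>

lemma splits_on_subset_U:
  assumes "i \<in> I" "W \<subseteq> U i"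
  shows "splits_on W (\<phi> i)"
  unfolding splits_on_def
proof (intro ballI conjI impI)
  fix x j assume "x \<in> W" "j \<in> I" "x \<in> U j"
  then show "affine_near N (\<phi> i j) x" using assms by (intro affine_\<phi>) auto
next
  fix x j k assume "x \<in> W" "j \<in> I" "k \<in> I" "x \<in> U j" "x \<in> U k"
  then show "\<phi> i k x = \<phi> i j x + \<phi> j k x" using assms by (intro cocycle) auto
qed

lemma splits_on_cong:
  assumes g: "splits_on W g" and "open W" and eq: "\<And>i x. i \<in> I \<Longrightarrow> x \<in> W \<Longrightarrow> x \<in> U i \<Longrightarrow> h i x = g i x"
  shows "splits_on W h"
  unfolding splits_on_def
proof (intro ballI conjI impI)
  fix x i assume x: "x \<in> W" "i \<in> I" "x \<in> U i"
  have "open (W \<inter> U i)" using \<open>open W\<close> open_U x by blast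
  then show "affine_near N (h i) x"
    by (rule affine_near_cong_open[OF splits_on_affine[OF g x]]) (simp_all add: x eq)
next
  fix x i j assume "x \<in> W" "i \<in> I" "j \<in> I" "x \<in> U i" "x \<in> U j"
  then show "h j x = h i x + \<phi> i j x" using eq[of i x] eq[of j x] splits_onD[OF g, of x i j] by simp
qed

lemma splits_on_add_affine:
  assumes "splits_on W g" "m \<in> dual_lattice N"
  shows "splits_on W (\<lambda>i x. g i x + (m x + a))"
  unfolding splits_on_def
proof (intro ballI conjI impI)
  fix x i assume "x \<in> W" "i \<in> I" "x \<in> U i"
  then show "affine_near N (\<lambda>x. g i x + (m x + a)) x"
    by (intro affine_near_add affine_near_affine assms(2) splits_on_affine[OF assms(1)])
next
  fix x i j assume "x \<in> W" "i \<in> I" "j \<in> I" "x \<in> U i" "x \<in> U j"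
  then show "g j x + (m x + a) = g i x + (m x + a) + \<phi> i j x"
    using splits_onD[OF assms(1), of x i j] by simp
qed

text \<open>The local differences of two splittings agree on overlaps because \<open>\<phi>\<close>
  cancels. They glue to one locally affine function on \<open>W\<close>, which is affine by
  connectedness.\<close>

lemma splits_on_unique:
  assumes g: "splits_on W g" "splits_on W h" and W: "open W" "connected W"
  shows "\<exists>m\<in>dual_lattice N. \<exists>a. \<forall>i\<in>I. \<forall>x\<in>W. x \<in> U i \<longrightarrow> g i x = h i x + (m x + a)"
proof -
  have "\<forall>x. \<exists>i. i \<in> I \<and> x \<in> U i" using cover_U by blast
  then obtain k where k: "\<And>x. k x \<in> I" "\<And>x. x \<in> U (k x)" by metis
  \<comment> \<open>An arbitrary chart \<open>k x\<close> is chosen at each point; the next fact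
    shows that the choice is immaterial.\<close>
  define d where "d x = g (k x) x - h (k x) x" for x
  have d: "d x = g i x - h i x" if "x \<in> W" "i \<in> I" "x \<in> U i" for x i
    using splits_onD[OF g(1), of x "k x" i] splits_onD[OF g(2), of x "k x" i] k that unfolding d_def by simp
  have "affine_near N d x" if x: "x \<in> W" for x
  proof (rule affine_near_cong_open)
    show "affine_near N (\<lambda>z. g (k x) z - h (k x) z) x"
      using splits_on_affine[OF g(1) x k] splits_on_affine[OF g(2) x k] by (rule affine_near_diff)
    show "open (W \<inter> U (k x))" using W(1) open_U k by blast
    show "x \<in> W \<inter> U (k x)" using x k by blast
    show "d z = g (k x) z - h (k x) z" if "z \<in> W \<inter> U (k x)" for z using d[of z "k x"] that k by simp
  qed
  from affine_near_imp_affine[OF W(2,1) this] obtain m a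
    where m: "m \<in> dual_lattice N" "\<forall>z\<in>W. d z = m z + a" by blast
  have "g i x = h i x + (m x + a)" if "i \<in> I" "x \<in> W" "x \<in> U i" for i x
    using d[of x i] m(2) that by simp
  then show ?thesis using m(1) by blast
qed

text \<open>On the connected intersection the two splittings differ by a single affine function.
  That function is defined everywhere, so it can be added to \<open>h\<close> on all of
  \<open>W\<close>, after which the two match.\<close>

lemma splits_on_Un:
  assumes V: "open V" "\<exists>g. splits_on V g" and W: "open W" "\<exists>g. splits_on W g"
    and conn: "connected (V \<inter> W)"
  shows "\<exists>g. splits_on (V \<union> W) g"
proof -
  obtain g where g: "splits_on V g" using V(2) ..
  obtain h where h: "splits_on W h" using W(2) ..
  from splits_on_unique[OF splits_on_mono[OF g Int_lower1] splits_on_mono[OF h Int_lower2]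
      open_Int[OF V(1) W(1)] conn]
  obtain m a where m: "m \<in> dual_lattice N"
    and eq: "\<forall>i\<in>I. \<forall>x\<in>V \<inter> W. x \<in> U i \<longrightarrow> g i x = h i x + (m x + a)"
    by (elim bexE exE)
  define f where "f i x = (if x \<in> V then g i x else h i x + (m x + a))" for i x
  have "splits_on V f" by (rule splits_on_cong[OF g V(1)]) (simp add: f_def)
  moreover have "splits_on W f"
    by (rule splits_on_cong[OF splits_on_add_affine[OF h m, of a] W(1)]) (simp add: f_def eq)
  ultimately have "splits_on (V \<union> W) f" unfolding splits_on_def by (simp only: ball_Un)
  then show ?thesis by (intro exI[of _ f])
qed

end

section \<open>Splitting affine cocycles on the universal cover\<close>

text \<open>An induction principle for subdividing one coordinate: a property of short intervals
  that survives the union of two overlapping intervals holds for all intervals.\<close>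

lemma interval_gluing:
  fixes Q :: "real \<Rightarrow> real \<Rightarrow> bool"
  assumes "\<delta> > 0" and short: "\<And>a b. b - a < \<delta> \<Longrightarrow> Q a b"
    and glue: "\<And>a b c d. a < c \<Longrightarrow> c < d \<Longrightarrow> d < b \<Longrightarrow> Q a d \<Longrightarrow> Q c b \<Longrightarrow> Q a b"
  shows "Q a b"
proof -
  \<comment> \<open>Each induction step lengthens the admissible intervals by half of
    \<open>\<delta>\<close>.\<close>
  have "Q a b" if "b - a < \<delta> * (1 + real k / 2)" for k a b
    using that
  proof (induction k arbitrary: a b)
    case (Suc k)
    show ?case
    proof (cases "b - a < \<delta>")
      case False
      \<comment> \<open>The left piece is short enough for the induction hypothesis; the right piece
        has length 3/4 of \<open>\<delta>\<close>, so the two overlap in a quarter of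
        \<open>\<delta>\<close>.\<close>
      have "Q a (b - \<delta> / 2)" by (rule Suc.IH) (use Suc.prems in \<open>simp add: algebra_simps add_divide_distrib\<close>)
      moreover have "Q (b - \<delta> * 3 / 4) b" by (rule short) (use assms(1) in simp)
      ultimately show ?thesis using glue[of a "b - \<delta> * 3 / 4" "b - \<delta> / 2" b] False assms(1) by simp
    qed (rule short)
  qed (simp add: short)
  moreover obtain k :: nat where "(b - a) / \<delta> * 2 < real k" using reals_Archimedean2 by blast
  then have "b - a < \<delta> * (1 + real k / 2)" using assms(1) by (simp add: field_simps)
  ultimately show ?thesis by blast
qed

text \<open>Adding one vector to \<open>B\<close> replaces the parallelepiped by its Minkowski sum
  with a segment, and sums of compact sets are compact.\<close>

lemma compact_parallelepiped:
  fixes B :: "'v::real_normed_vector set"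
  assumes "finite B"
  shows "compact {\<Sum>b\<in>B. c b *\<^sub>R b | c. \<forall>b\<in>B. c b \<in> {-n..n::real}}"
  using assms
proof (induction B)
  case (insert b B)
  have "{\<Sum>b\<in>insert b B. c b *\<^sub>R b | c. \<forall>b\<in>insert b B. c b \<in> {-n..n}} =
     {x + y | x y. x \<in> (\<lambda>t. t *\<^sub>R b) ` {-n..n} \<and> y \<in> {\<Sum>b\<in>B. c b *\<^sub>R b | c. \<forall>b\<in>B. c b \<in> {-n..n}}}"
    (is "?L = ?R")
  proof
    show "?L \<subseteq> ?R"
    proof
      fix z assume "z \<in> ?L"
      then obtain c where c: "\<forall>b\<in>insert b B. c b \<in> {-n..n}" "z = c b *\<^sub>R b + (\<Sum>b\<in>B. c b *\<^sub>R b)"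
        using insert.hyps by auto
      then show "z \<in> ?R"
        by (intro CollectI exI[of _ "c b *\<^sub>R b"] exI[of _ "\<Sum>b\<in>B. c b *\<^sub>R b"]) blast
    qed
    show "?R \<subseteq> ?L"
    proof
      fix z assume "z \<in> ?R"
      then obtain t c where t: "t \<in> {-n..n}" "\<forall>b\<in>B. c b \<in> {-n..n}" "z = t *\<^sub>R b + (\<Sum>b\<in>B. c b *\<^sub>R b)"
        by auto
      have "(\<Sum>x\<in>B. (c(b := t)) x *\<^sub>R x) = (\<Sum>b\<in>B. c b *\<^sub>R b)"
        using insert.hyps by (intro sum.cong) auto
      then have "z = (\<Sum>x\<in>insert b B. (c(b := t)) x *\<^sub>R x)" using t insert.hyps by simp
      then show "z \<in> ?L" using t by (intro CollectI exI[of _ "c(b := t)"] conjI) simp_all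
    qed
  qed
  moreover have "compact ?R"
    by (intro compact_sums insert.IH compact_continuous_image continuous_intros compact_Icc)
  ultimately show ?case by simp
qed simp

section \<open>Open boxes in the coordinates of a basis\<close>

definition open_box :: "'v::real_normed_vector set \<Rightarrow> ('v \<Rightarrow> real) \<Rightarrow> ('v \<Rightarrow> real) \<Rightarrow> 'v set" where
  "open_box B lo hi = {x. \<forall>b\<in>B. lo b < representation B x b \<and> representation B x b < hi b}"

lemma open_box_split:
  assumes "b \<in> B" "p < q" "q < r" "r < s"
  shows "open_box B (lo(b := p)) (hi(b := s)) =
    open_box B (lo(b := p)) (hi(b := r)) \<union> open_box B (lo(b := q)) (hi(b := s))"
proof -
  have eq: "open_box B (lo(b := p)) (hi(b := s)) = {x. p < representation B x b \<and> representation B x b < s \<and>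
      (\<forall>c\<in>B - {b}. lo c < representation B x c \<and> representation B x c < hi c)}" for p s
    unfolding open_box_def using assms(1) by auto
  show ?thesis unfolding eq using assms(2-4) by auto
qed

context
  fixes B :: "'v::real_normed_vector set"
  assumes B: "finite B" "independent B" "span B = UNIV"
begin

lemma representation_sum: "(\<Sum>b\<in>B. representation B x b *\<^sub>R b) = x"
  using B by (intro real_vector.sum_representation_eq) auto

lemma linear_representation: "linear (\<lambda>x. representation B x b)"
  using B by (intro linearI) (simp_all add: real_vector.representation_add real_vector.representation_scale)

lemma continuous_representation:
  assumes "full_lattice (M :: 'v set)"
  shows "continuous_on UNIV (\<lambda>x. representation B x b)"
  by (rule full_lattice_linear_continuous[OF assms linear_representation])

lemma open_open_box:
  assumes "full_lattice (M :: 'v set)"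
  shows "open (open_box B lo hi)"
proof -
  have "open_box B lo hi = (\<Inter>b\<in>B. {x. lo b < representation B x b} \<inter> {x. representation B x b < hi b})"
    by (auto simp: open_box_def)
  also have "open \<dots>"
    using B(1) by (intro open_INT ballI open_Int open_Collect_less continuous_on_const
        continuous_representation[OF assms])
  finally show ?thesis .
qed

lemma convex_open_box: "convex (open_box B lo hi)"
proof -
  have "convex ((\<lambda>x. representation B x b) -` {lo b<..<hi b})" for b
    by (intro convex_linear_vimage linear_representation convex_real_interval)
  moreover have "open_box B lo hi = (\<Inter>b\<in>B. (\<lambda>x. representation B x b) -` {lo b<..<hi b})"
    by (auto simp: open_box_def)
  ultimately show ?thesis by (auto intro: convex_INT)
qed

text \<open>Two points of the box differ by at most \<open>\<delta>\<close> in each coordinate; the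
  triangle inequality turns this into a bound on the norm.\<close>

lemma open_box_subset_ball:
  assumes "\<And>b. b \<in> B \<Longrightarrow> hi b - lo b < \<delta>" "x \<in> open_box B lo hi" "\<delta> > 0"
  shows "open_box B lo hi \<subseteq> ball x (\<delta> * (1 + (\<Sum>b\<in>B. norm b)))"
proof
  fix y assume y: "y \<in> open_box B lo hi"
  have "dist x y = norm (\<Sum>b\<in>B. (representation B x b - representation B y b) *\<^sub>R b)"
    by (simp add: dist_norm scaleR_left_diff_distrib sum_subtractf representation_sum)
  also have "\<dots> \<le> (\<Sum>b\<in>B. \<delta> * norm b)"
  proof (rule sum_norm_le)
    fix b assume b: "b \<in> B"
    have "lo b < representation B x b" "representation B x b < hi b"
      "lo b < representation B y b" "representation B y b < hi b"
      using assms(2) y b by (auto simp: open_box_def)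
    then have "\<bar>representation B x b - representation B y b\<bar> \<le> \<delta>" using assms(1)[OF b] by linarith
    then show "norm ((representation B x b - representation B y b) *\<^sub>R b) \<le> \<delta> * norm b"
      by (simp add: mult_right_mono)
  qed
  \<comment> \<open>The summand 1 makes the inequality strict, also when \<open>B\<close> is
    empty.\<close>
  also have "\<dots> < \<delta> * (1 + (\<Sum>b\<in>B. norm b))"
    using assms(3) by (simp add: sum_distrib_left[symmetric])
  finally show "y \<in> ball x (\<delta> * (1 + (\<Sum>b\<in>B. norm b)))" by simp
qed

lemma open_box_subset_parallelepiped:
  assumes "\<And>b. b \<in> B \<Longrightarrow> -n \<le> lo b \<and> hi b \<le> n"
  shows "open_box B lo hi \<subseteq> {\<Sum>b\<in>B. c b *\<^sub>R b | c. \<forall>b\<in>B. c b \<in> {-n..n}}"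
proof
  fix x assume x: "x \<in> open_box B lo hi"
  have "\<forall>b\<in>B. representation B x b \<in> {-n..n}"
    using x assms unfolding open_box_def by force
  then show "x \<in> {\<Sum>b\<in>B. c b *\<^sub>R b | c. \<forall>b\<in>B. c b \<in> {-n..n}}"
    using representation_sum[of x] by (intro CollectI exI[of _ "representation B x"]) simp
qed

lemma ex_open_box: "\<exists>n. x \<in> open_box B (\<lambda>_. - real (Suc n)) (\<lambda>_. real (Suc n))"
proof -
  obtain n where n: "Max (insert 0 ((\<lambda>b. \<bar>representation B x b\<bar>) ` B)) < real n"
    using reals_Archimedean2 by blast
  have "\<bar>representation B x b\<bar> < real (Suc n)" if "b \<in> B" for b
  proof -
    have "\<bar>representation B x b\<bar> \<le> Max (insert 0 ((\<lambda>b. \<bar>representation B x b\<bar>) ` B))"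
      using B(1) that by (intro Max_ge) auto
    then show ?thesis using n by simp
  qed
  then have "x \<in> open_box B (\<lambda>_. - real (Suc n)) (\<lambda>_. real (Suc n))"
    unfolding open_box_def abs_less_iff by (intro CollectI ballI) (use minus_less_iff in blast)
  then show ?thesis by blast
qed

end

section \<open>Splitting over boxes and over the whole space\<close>

context affine_cocycle
begin

text \<open>A Lebesgue number \<open>\<epsilon>\<close> of the cover on the compact set
  \<open>C\<close> puts every box with all sides below \<open>\<delta>\<close> into one chart, where
  a splitting is known. Longer boxes are obtained by gluing along one coordinate at a time.\<close>

lemma splits_on_open_box:
  fixes B M :: "'v set"
  assumes B: "finite B" "independent B" "span B = UNIV" and M: "full_lattice M"
    and bounds: "\<And>b. b \<in> B \<Longrightarrow> -n \<le> lo b \<and> hi b \<le> n"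
  shows "\<exists>g. splits_on (open_box B lo hi) g"
proof -
  define C where "C = {\<Sum>b\<in>B. c b *\<^sub>R b | c. \<forall>b\<in>B. c b \<in> {-n..n}}"
  have cov: "C \<subseteq> \<Union> (U ` I)" "\<And>G. G \<in> U ` I \<Longrightarrow> open G"
    using cover_U open_U by auto
  have "compact C" unfolding C_def by (rule compact_parallelepiped[OF B(1)])
  then obtain \<epsilon> where \<epsilon>: "\<epsilon> > 0" "\<And>x. x \<in> C \<Longrightarrow> \<exists>G\<in>U ` I. ball x \<epsilon> \<subseteq> G"
    using cov by (rule Heine_Borel_lemma) auto
  define S where "S = 1 + (\<Sum>b\<in>B. norm b)"
  have S: "S > 0" unfolding S_def by (intro add_pos_nonneg sum_nonneg) auto
  define \<delta> where "\<delta> = \<epsilon> / S"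
  have \<delta>: "\<delta> > 0" "\<delta> * S = \<epsilon>" unfolding \<delta>_def using \<epsilon> S by auto
  \<comment> \<open>\<open>T\<close> is the set of coordinates in which the box may be long. The
    induction frees one coordinate after another, and \<open>T = B\<close> is the claim.\<close>
  have "\<exists>g. splits_on (open_box B lo hi) g"
    if "finite T" "T \<subseteq> B" "\<And>b. b \<in> B \<Longrightarrow> -n \<le> lo b \<and> hi b \<le> n"
      "\<And>b. b \<in> B - T \<Longrightarrow> hi b - lo b < \<delta>" for T lo hi
    using that
  proof (induction T arbitrary: lo hi rule: finite_induct)
    case empty
    show ?case
    proof (cases "open_box B lo hi = {}")
      case True
      then show ?thesis by (simp add: splits_on_def)
    next
      case False
      then obtain x where x: "x \<in> open_box B lo hi" by blast
      have "open_box B lo hi \<subseteq> C"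
        unfolding C_def by (rule open_box_subset_parallelepiped[OF B empty(2)])
      then have "x \<in> C" using x by blast
      then obtain i where i: "i \<in> I" "ball x \<epsilon> \<subseteq> U i" using \<epsilon>(2) by blast
      have "open_box B lo hi \<subseteq> ball x \<epsilon>"
        using open_box_subset_ball[OF B _ x \<delta>(1)] empty(3) \<delta>(2) unfolding S_def by simp
      then have "splits_on (open_box B lo hi) (\<phi> i)" using i by (intro splits_on_subset_U) auto
      then show ?thesis by blast
    qed
  next
    case (insert b T)
    have b: "b \<in> B" using insert.prems by simp
    \<comment> \<open>The bounds are premises inside \<open>Q\<close> because
      \<open>interval_gluing\<close> ranges over all intervals, while splittings are sought only for
      boxes within \<open>C\<close>.\<close>
    define Q where "Q p q \<longleftrightarrow> (-n \<le> p \<longrightarrow> q \<le> n \<longrightarrow> (\<exists>g. splits_on (open_box B (lo(b := p)) (hi(b := q))) g))" for p q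
    have "Q (lo b) (hi b)"
    proof (rule interval_gluing[OF \<delta>(1)])
      fix p q :: real assume pq: "q - p < \<delta>"
      show "Q p q" unfolding Q_def
      proof (intro impI)
        assume "-n \<le> p" "q \<le> n"
        then show "\<exists>g. splits_on (open_box B (lo(b := p)) (hi(b := q))) g"
          using insert.prems insert.hyps pq by (intro insert.IH) auto
      qed
    next
      fix p q r s :: real assume less: "p < r" "r < s" "s < q" and Q: "Q p s" "Q r q"
      show "Q p q" unfolding Q_def
      proof (intro impI)
        assume n: "-n \<le> p" "q \<le> n"
        show "\<exists>g. splits_on (open_box B (lo(b := p)) (hi(b := q))) g"
          unfolding open_box_split[OF b less]
          using Q n less unfolding Q_def
          by (intro splits_on_Un open_open_box[OF B M] convex_connected convex_Int convex_open_box[OF B]) auto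
      qed
    qed
    then show ?case using insert.prems b unfolding Q_def by simp
  qed
  from this[of B lo hi] show ?thesis using B(1) bounds by simp
qed

text \<open>The boxes \<open>K n\<close> exhaust the space, but splittings over them agree only up
  to affine functions. Fixing their germs at the origin removes this freedom, so that they define
  one splitting on the union.\<close>

theorem splits_on_UNIV:
  assumes M: "full_lattice (M :: 'v set)"
  shows "\<exists>g. splits_on UNIV g"
proof -
  obtain B :: "'v set" where B: "finite B" "independent B" "span B = UNIV"
    using M unfolding full_lattice_def by blast
  define K where "K n = open_box B (\<lambda>_. - real (Suc n)) (\<lambda>_. real (Suc n))" for n
  have openK: "open (K n)" for n unfolding K_def by (rule open_open_box[OF B M])
  have connK: "connected (K n)" for n unfolding K_def by (intro convex_connected convex_open_box[OF B])
  have monoK: "K n \<subseteq> K k" if "n \<le> k" for n k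
    using that unfolding K_def open_box_def by (force intro: less_le_trans le_less_trans)
  have zeroK: "0 \<in> K n" for n
    unfolding K_def open_box_def using B by (simp add: real_vector.representation_zero)
  obtain i0 where i0: "i0 \<in> I" "0 \<in> U i0" using cover_U by blast
  \<comment> \<open>Splittings normalised to have the zero germ at the origin agree on smaller boxes.\<close>
  have "\<exists>g. splits_on (K n) g \<and> (\<forall>\<^sub>F z in nhds 0. g i0 z = 0)" for n
  proof -
    have "\<exists>g. splits_on (K n) g"
      unfolding K_def by (rule splits_on_open_box[OF B M, where n = "real (Suc n)"]) simp
    then obtain g where g: "splits_on (K n) g" ..
    obtain m a where m: "m \<in> dual_lattice N" "\<forall>\<^sub>F z in nhds 0. g i0 z = m z + a"
      by (rule affine_nearE[OF splits_on_affine[OF g zeroK i0]])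
    from m(2) have "\<forall>\<^sub>F z in nhds 0. g i0 z + (- m z + - a) = 0" by eventually_elim simp
    then show ?thesis
      using splits_on_add_affine[OF g dual_lattice_minus[OF m(1)], of "- a"]
      by (intro exI[of _ "\<lambda>i z. g i z + (- m z + - a)"]) simp
  qed
  then obtain g where g: "\<And>n. splits_on (K n) (g n)" and g0: "\<And>n. \<forall>\<^sub>F z in nhds 0. g n i0 z = 0"
    by metis
  have le: "g k i x = g n i x" if nk: "n \<le> k" and that: "x \<in> K n" "i \<in> I" "x \<in> U i" for n k i x
  proof -
    obtain m a where m: "m \<in> dual_lattice N"
      and eq: "\<forall>i\<in>I. \<forall>x\<in>K n. x \<in> U i \<longrightarrow> g k i x = g n i x + (m x + a)"
      using splits_on_unique[OF splits_on_mono[OF g monoK[OF nk]] g openK connK] by blast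
    have "\<forall>\<^sub>F z in nhds 0. z \<in> K n \<inter> U i0"
      using openK open_U i0 zeroK by (intro eventually_nhds_in_open) auto
    \<comment> \<open>The affine difference of two normalised splittings vanishes near the origin,
      hence everywhere by uniqueness of germs.\<close>
    with g0[of n] g0[of k] have "\<forall>\<^sub>F z in nhds 0. m z + a = 0 + 0"
      by eventually_elim (use eq i0 in auto)
    then have "m = (\<lambda>_. 0) \<and> a = 0"
      using affine_germ_unique[OF dual_lattice_linear[OF m] dual_lattice_linear[OF dual_lattice_zero]] by blast
    then show ?thesis using eq that by simp
  qed
  have agree: "g k i x = g n i x" if "x \<in> K n" "x \<in> K k" "i \<in> I" "x \<in> U i" for n k i x
    using le[of n k x i] le[of k n x i] that by (cases n k rule: le_cases) auto
  have "\<forall>x. \<exists>n. x \<in> K n" unfolding K_def using ex_open_box[OF B] by blast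
  then obtain \<nu> where \<nu>: "\<And>x. x \<in> K (\<nu> x)" by metis
  define G where "G i x = g (\<nu> x) i x" for i x
  have "splits_on (K n) G" for n
  proof (rule splits_on_cong[OF g openK])
    fix i x assume "i \<in> I" "x \<in> K n" "x \<in> U i"
    then show "G i x = g n i x" using agree[of x n "\<nu> x" i] \<nu> unfolding G_def by simp
  qed
  then have "splits_on (\<Union>n. K n) G" unfolding splits_on_def by blast
  moreover have "(\<Union>n. K n) = UNIV" using \<nu> by blast
  ultimately have "splits_on UNIV G" by simp
  then show ?thesis by (intro exI[of _ G])
qed

end

section \<open>Morphisms of tropical line bundles\<close>

lemma open_coset_vimage: "openin (torus \<Lambda>) U \<Longrightarrow> open {x. coset \<Lambda> x \<in> U}"
  by (simp add: torus_def openin_quotient_topology)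

lemma integral_form_zero: "integral_form N \<Lambda> (\<lambda>_ _. 0)"
  by (auto simp: integral_form_def bilinear_def module_hom_zero)

lemma linear_zero_form: "linear (\<lambda>_. 0 :: real)"
  by (simp add: module_hom_zero)

text \<open>The facts about \<open>\<Lambda>\<close> alone are available only in the presence of a form and a linear
  functional, for which zero will do.\<close>

lemmas lattice_coset_eq_iff = coset_eq_iff[OF _ integral_form_zero linear_zero_form]
lemmas lattice_chart_cover = chart_cover[OF _ integral_form_zero linear_zero_form]
lemmas lattice_openin_coset_image = openin_coset_image[OF _ integral_form_zero linear_zero_form]

lemma topspace_lattice_torus: "topspace (torus \<Lambda>) = range (coset \<Lambda>)"
  by (simp add: torus_def)

lemma aff_sectionsI:
  assumes "full_lattice \<Lambda>" "openin (torus \<Lambda>) U"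
    and "\<And>x. coset \<Lambda> x \<in> U \<Longrightarrow> affine_near N (\<lambda>z. \<phi> (coset \<Lambda> z)) x"
  shows "\<phi> \<in> aff_sections N \<Lambda> U"
proof (rule locally_affine_imp_aff[OF assms(1) integral_form_zero linear_zero_form assms(2)])
  fix x assume "coset \<Lambda> x \<in> U"
  from affine_nearE[OF assms(3)[OF this]] obtain m a
    where m: "m \<in> dual_lattice N" "\<forall>\<^sub>F z in nhds x. \<phi> (coset \<Lambda> z) = m z + a" .
  then obtain W where "open W" "x \<in> W" "\<forall>z\<in>W. \<phi> (coset \<Lambda> z) = m z + a"
    unfolding eventually_nhds by (elim exE conjE)
  then show "\<exists>W m a. open W \<and> x \<in> W \<and> m \<in> dual_lattice N \<and>
      (\<forall>z\<in>W. coset \<Lambda> z \<in> U \<longrightarrow> \<phi> (coset \<Lambda> z) = m z + a)"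
    by (intro exI[of _ W] exI[of _ m] exI[of _ a]) (simp add: m(1))
qed

text \<open>As \<open>U\<close> is open, its preimage is a neighbourhood of \<open>x\<close>, which
  absorbs the side condition in \<open>aff_sections\<close>.\<close>

lemma aff_sections_affine_near:
  assumes "\<phi> \<in> aff_sections N \<Lambda> U" "openin (torus \<Lambda>) U" "coset \<Lambda> x \<in> U"
  shows "affine_near N (\<lambda>z. \<phi> (coset \<Lambda> z)) x"
proof -
  obtain W m a where W: "open W" "x \<in> W" and m: "m \<in> dual_lattice N"
    and eq: "\<forall>z\<in>W. coset \<Lambda> z \<in> U \<longrightarrow> \<phi> (coset \<Lambda> z) = m z + a"
    using assms(1,3) unfolding aff_sections_def by blast
  show ?thesis
    by (rule affine_near_cong_open[OF affine_near_affine[OF m, of a] open_Int[OF W(1) open_coset_vimage[OF assms(2)]]])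
       (use W(2) assms(3) eq in auto)
qed

lemma aff_sections_minus:
  assumes "full_lattice \<Lambda>" "openin (torus \<Lambda>) U" "\<phi> \<in> aff_sections N \<Lambda> U"
  shows "(\<lambda>c. - \<phi> c) \<in> aff_sections N \<Lambda> U"
  by (intro aff_sectionsI assms(1,2) affine_near_minus aff_sections_affine_near[OF assms(3,2)])

section \<open>Charts of a tropical line bundle and maps between bundles\<close>

lemma
  assumes L: "tropical_line_bundle N \<Lambda> L"
  shows tropical_proj_continuous: "continuous_map (tot L) (torus \<Lambda>) (proj L)"
    and tropical_cover: "c \<in> topspace (torus \<Lambda>) \<Longrightarrow> \<exists>(U, t)\<in>atlas L. c \<in> U"
    and tropical_open: "(U, t) \<in> atlas L \<Longrightarrow> openin (torus \<Lambda>) U"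
    and tropical_chart: "(U, t) \<in> atlas L \<Longrightarrow>
      homeomorphic_map (subtopology (tot L) (over L U))
        (prod_topology (subtopology (torus \<Lambda>) U) euclideanreal) (\<lambda>y. (proj L y, t y))"
    and tropical_transition: "(U, t) \<in> atlas L \<Longrightarrow> (U', t') \<in> atlas L \<Longrightarrow>
      \<exists>\<phi>\<in>aff_sections N \<Lambda> (U \<inter> U'). \<forall>y\<in>over L (U \<inter> U'). t' y = t y + \<phi> (proj L y)"
  using L unfolding tropical_line_bundle_def by fast+

lemma tropical_proj:
  "tropical_line_bundle N \<Lambda> L \<Longrightarrow> y \<in> topspace (tot L) \<Longrightarrow> proj L y \<in> topspace (torus \<Lambda>)"
  using tropical_proj_continuous by (fastforce simp: continuous_map_def)

lemma openin_over:
  assumes "tropical_line_bundle N \<Lambda> L" "openin (torus \<Lambda>) U"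
  shows "openin (tot L) (over L U)"
  unfolding over_def by (rule openin_continuous_map_preimage[OF tropical_proj_continuous[OF assms(1)] assms(2)])

lemma over_subset_topspace: "over L U \<subseteq> topspace (tot L)"
  by (auto simp: over_def)

lemma tropical_chart_inj:
  assumes "tropical_line_bundle N \<Lambda> L" "(U, t) \<in> atlas L"
    and "y \<in> over L U" "z \<in> over L U" "proj L y = proj L z" "t y = t z"
  shows "y = z"
proof -
  have "inj_on (\<lambda>y. (proj L y, t y)) (over L U)"
    using homeomorphic_imp_injective_map[OF tropical_chart[OF assms(1,2)]]
    by (simp add: Int_absorb1 over_subset_topspace)
  then show ?thesis using assms(3-6) by (auto dest: inj_onD)
qed

lemma tropical_chart_surj:
  assumes "tropical_line_bundle N \<Lambda> L" "(U, t) \<in> atlas L" "c \<in> U"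
  shows "\<exists>y\<in>over L U. proj L y = c \<and> t y = b"
proof -
  have "(\<lambda>y. (proj L y, t y)) ` (over L U) = U \<times> UNIV"
    using homeomorphic_imp_surjective_map[OF tropical_chart[OF assms(1,2)]]
      openin_subset[OF tropical_open[OF assms(1,2)]]
    by (simp add: Int_absorb1 over_subset_topspace)
  then have "(c, b) \<in> (\<lambda>y. (proj L y, t y)) ` (over L U)" using assms(3) by simp
  then show ?thesis by auto
qed

text \<open>Over the intersection of two chart domains, \<open>f\<close> is the continuous map
  \<open>(proj L y, t y + \<phi> (proj L y))\<close> followed by the inverse \<open>k\<close> of the
  target chart. These local descriptions are pasted together.\<close>

lemma fibre_map_continuous:
  assumes L: "tropical_line_bundle N \<Lambda> L" and L': "tropical_line_bundle N \<Lambda> L'"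
    and f: "\<And>y. y \<in> topspace (tot L) \<Longrightarrow> f y \<in> topspace (tot L')"
    and pr: "\<And>y. y \<in> topspace (tot L) \<Longrightarrow> proj L' (f y) = proj L y"
    and charts: "\<And>U t U' t'. (U, t) \<in> atlas L \<Longrightarrow> (U', t') \<in> atlas L' \<Longrightarrow>
        \<exists>\<phi>\<in>aff_sections N \<Lambda> (U \<inter> U'). \<forall>y\<in>over L (U \<inter> U'). t' (f y) = t y + \<phi> (proj L y)"
  shows "continuous_map (tot L) (tot L') f"
proof (rule pasting_lemma[where I = "atlas L \<times> atlas L'" and T = "\<lambda>i. over L (fst (fst i) \<inter> fst (snd i))"
      and f = "\<lambda>_. f"])
  fix i assume i: "i \<in> atlas L \<times> atlas L'"
  then obtain U t U' t' where [simp]: "i = ((U, t), (U', t'))"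
    and U: "(U, t) \<in> atlas L" and U': "(U', t') \<in> atlas L'" by auto
  let ?X = "subtopology (tot L) (over L (U \<inter> U'))"
  have op: "openin (torus \<Lambda>) (U \<inter> U')"
    by (intro openin_Int tropical_open[OF L U] tropical_open[OF L' U'])
  then show "openin (tot L) (over L (fst (fst i) \<inter> fst (snd i)))"
    by (simp add: openin_over[OF L])
  obtain \<phi> where \<phi>: "\<phi> \<in> aff_sections N \<Lambda> (U \<inter> U')"
    and t': "\<forall>y\<in>over L (U \<inter> U'). t' (f y) = t y + \<phi> (proj L y)"
    using charts[OF U U'] by blast
  from \<phi> have c\<phi>: "continuous_map (subtopology (torus \<Lambda>) (U \<inter> U')) euclideanreal \<phi>"
    unfolding aff_sections_def by blast
  obtain k where k: "homeomorphic_maps (subtopology (tot L') (over L' U'))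
      (prod_topology (subtopology (torus \<Lambda>) U') euclideanreal) (\<lambda>y. (proj L' y, t' y)) k"
    using tropical_chart[OF L' U'] by (auto simp: homeomorphic_map_maps)
  have prX: "continuous_map ?X (subtopology (torus \<Lambda>) (U \<inter> U')) (proj L)"
    unfolding continuous_map_in_subtopology
    by (auto simp: over_def intro!: continuous_map_from_subtopology[OF tropical_proj_continuous[OF L]])
  have "continuous_map (subtopology (tot L) (over L U)) euclideanreal t"
    using homeomorphic_imp_continuous_map[OF tropical_chart[OF L U]]
    unfolding continuous_map_pairwise by (simp add: o_def)
  then have tX: "continuous_map ?X euclideanreal t"
    by (rule continuous_map_from_subtopology_mono) (auto simp: over_def)
  have "continuous_map ?X (prod_topology (subtopology (torus \<Lambda>) U') euclideanreal)
     (\<lambda>y. (proj L y, t y + \<phi> (proj L y)))"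
    unfolding continuous_map_paired
  proof
    show "continuous_map ?X (subtopology (torus \<Lambda>) U') (proj L)"
      using prX by (auto simp: continuous_map_in_subtopology)
    show "continuous_map ?X euclideanreal (\<lambda>y. t y + \<phi> (proj L y))"
      using continuous_map_compose[OF prX c\<phi>] tX by (intro continuous_map_add) (auto simp: o_def)
  qed
  moreover have "continuous_map (prod_topology (subtopology (torus \<Lambda>) U') euclideanreal)
      (subtopology (tot L') (over L' U')) k"
    using k by (simp add: homeomorphic_maps_def)
  ultimately have "continuous_map ?X (subtopology (tot L') (over L' U'))
      (k \<circ> (\<lambda>y. (proj L y, t y + \<phi> (proj L y))))"
    by (rule continuous_map_compose)
  then have "continuous_map ?X (tot L') (k \<circ> (\<lambda>y. (proj L y, t y + \<phi> (proj L y))))"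
    by (simp add: continuous_map_in_subtopology)
  moreover have "(k \<circ> (\<lambda>y. (proj L y, t y + \<phi> (proj L y)))) y = f y" if "y \<in> topspace ?X" for y
  proof -
    have y: "y \<in> over L (U \<inter> U')" "y \<in> topspace (tot L)" using that by (auto simp: over_def)
    then have "f y \<in> topspace (subtopology (tot L') (over L' U'))"
      using f[OF y(2)] pr[OF y(2)] by (auto simp: over_def)
    then have "k (proj L' (f y), t' (f y)) = f y" using k unfolding homeomorphic_maps_def by blast
    then show ?thesis using t' y pr by simp
  qed
  ultimately have "continuous_map ?X (tot L') f" by (rule continuous_map_eq)
  then show "continuous_map (subtopology (tot L) (over L (fst (fst i) \<inter> fst (snd i)))) (tot L') f"
    by simp
next
  fix y assume y: "y \<in> topspace (tot L)"
  then have "proj L y \<in> topspace (torus \<Lambda>)" by (rule tropical_proj[OF L])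
  then show "\<exists>j. j \<in> atlas L \<times> atlas L' \<and> y \<in> over L (fst (fst j) \<inter> fst (snd j)) \<and> f y = f y"
    using tropical_cover[OF L] tropical_cover[OF L'] y by (fastforce simp: over_def)
qed simp

text \<open>A map that translates fibres in charts is bijective, and its inverse translates by the
  negated affine functions. Continuity in both directions therefore follows from
  \<open>fibre_map_continuous\<close>.\<close>

lemma tropical_isoI:
  assumes \<Lambda>: "full_lattice \<Lambda>"
    and L: "tropical_line_bundle N \<Lambda> L" and L': "tropical_line_bundle N \<Lambda> L'"
    and f: "\<And>y. y \<in> topspace (tot L) \<Longrightarrow> f y \<in> topspace (tot L')"
    and pr: "\<And>y. y \<in> topspace (tot L) \<Longrightarrow> proj L' (f y) = proj L y"
    and charts: "\<And>U t U' t'. (U, t) \<in> atlas L \<Longrightarrow> (U', t') \<in> atlas L' \<Longrightarrow>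
        \<exists>\<phi>\<in>aff_sections N \<Lambda> (U \<inter> U'). \<forall>y\<in>over L (U \<inter> U'). t' (f y) = t y + \<phi> (proj L y)"
  shows "tropical_iso N \<Lambda> L L' f"
proof -
  have ex: "\<exists>U t U' t' \<phi>. (U, t) \<in> atlas L \<and> (U', t') \<in> atlas L' \<and> c \<in> U \<and> c \<in> U' \<and>
      (\<forall>y\<in>over L (U \<inter> U'). t' (f y) = t y + \<phi> (proj L y))"
    if "c \<in> topspace (torus \<Lambda>)" for c
    using tropical_cover[OF L that] tropical_cover[OF L' that] charts by fast
  have inj: "inj_on f (topspace (tot L))"
  proof (rule inj_onI)
    fix y z assume y: "y \<in> topspace (tot L)" and z: "z \<in> topspace (tot L)" and eq: "f y = f z"
    then have p: "proj L y = proj L z" using pr by metis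
    obtain U t U' t' \<phi> where U: "(U, t) \<in> atlas L" "proj L y \<in> U" "proj L y \<in> U'"
      and t: "\<forall>y\<in>over L (U \<inter> U'). t' (f y) = t y + \<phi> (proj L y)"
      using ex[OF tropical_proj[OF L y]] by blast
    have yz: "y \<in> over L (U \<inter> U')" "z \<in> over L (U \<inter> U')" using U y z p by (auto simp: over_def)
    then have "t y + \<phi> (proj L y) = t z + \<phi> (proj L z)" using t eq by metis
    then have "t y = t z" using p by simp
    with yz show "y = z" by (intro tropical_chart_inj[OF L U(1) _ _ p]) (auto simp: over_def)
  qed
  have surj: "z \<in> f ` topspace (tot L)" if z: "z \<in> topspace (tot L')" for z
  proof -
    obtain U t U' t' \<phi> where U: "(U, t) \<in> atlas L" "(U', t') \<in> atlas L'" "proj L' z \<in> U" "proj L' z \<in> U'"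
      and t: "\<forall>y\<in>over L (U \<inter> U'). t' (f y) = t y + \<phi> (proj L y)"
      using ex[OF tropical_proj[OF L' z]] by blast
    \<comment> \<open>The coordinate of the preimage is forced by the translation formula.\<close>
    obtain y where y: "y \<in> over L U" "proj L y = proj L' z" "t y = t' z - \<phi> (proj L' z)"
      using tropical_chart_surj[OF L U(1,3)] by blast
    then have yt: "y \<in> topspace (tot L)" and "y \<in> over L (U \<inter> U')" using U by (auto simp: over_def)
    then have "t' (f y) = t' z" using t y by simp
    moreover have "f y \<in> over L' U'" "z \<in> over L' U'" "proj L' (f y) = proj L' z"
      using f[OF yt] pr[OF yt] y U z by (auto simp: over_def)
    ultimately have "f y = z" by (intro tropical_chart_inj[OF L' U(2)])
    then show ?thesis using yt by blast
  qed
  define g where "g = inv_into (topspace (tot L)) f"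
  have g: "g z \<in> topspace (tot L)" "f (g z) = z" if "z \<in> topspace (tot L')" for z
    using surj[OF that] unfolding g_def by (auto intro: inv_into_into f_inv_into_f)
  have gf: "g (f y) = y" if "y \<in> topspace (tot L)" for y
    using inj that unfolding g_def by simp
  have prg: "proj L (g z) = proj L' z" if "z \<in> topspace (tot L')" for z
    using pr[OF g(1)[OF that]] g(2)[OF that] by simp
  have "continuous_map (tot L') (tot L) g"
  proof (rule fibre_map_continuous[OF L' L g(1) prg])
    fix U t U' t' assume U: "(U, t) \<in> atlas L'" "(U', t') \<in> atlas L"
    obtain \<phi> where \<phi>: "\<phi> \<in> aff_sections N \<Lambda> (U' \<inter> U)"
      and t: "\<forall>y\<in>over L (U' \<inter> U). t (f y) = t' y + \<phi> (proj L y)"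
      using charts[OF U(2,1)] by blast
    have "openin (torus \<Lambda>) (U' \<inter> U)"
      by (intro openin_Int tropical_open[OF L U(2)] tropical_open[OF L' U(1)])
    from aff_sections_minus[OF \<Lambda> this \<phi>] have "(\<lambda>c. - \<phi> c) \<in> aff_sections N \<Lambda> (U \<inter> U')"
      by (simp add: Int_commute)
    moreover have "t' (g z) = t z + - \<phi> (proj L' z)" if z: "z \<in> over L' (U \<inter> U')" for z
    proof -
      have z': "z \<in> topspace (tot L')" using z by (simp add: over_def)
      then have "g z \<in> over L (U' \<inter> U)" using z g(1) prg by (auto simp: over_def)
      then have "t (f (g z)) = t' (g z) + \<phi> (proj L (g z))" using t by blast
      then show ?thesis using g(2) prg z' by simp
    qed
    ultimately show "\<exists>\<phi>\<in>aff_sections N \<Lambda> (U \<inter> U'). \<forall>y\<in>over L' (U \<inter> U'). t' (g y) = t y + \<phi> (proj L' y)"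
      by (intro bexI[of _ "\<lambda>c. - \<phi> c"] ballI)
  qed
  then have "homeomorphic_maps (tot L) (tot L') f g"
    using fibre_map_continuous[OF L L' f pr charts] g(2) gf by (simp add: homeomorphic_maps_def)
  then have "homeomorphic_map (tot L) (tot L') f" by (auto simp: homeomorphic_map_maps)
  then show ?thesis unfolding tropical_iso_def using pr charts by fast
qed

section \<open>Automorphy factors\<close>

lemma full_lattice_scale_int:
  assumes "full_lattice M" "v \<in> M"
  shows "of_int k *\<^sub>R v \<in> M"
proof (induction k rule: int_induct[where k = 0])
  case base
  then show ?case by (simp add: full_lattice_zero[OF assms(1)])
next
  case (step1 i)
  then show ?case using full_lattice_add[OF assms(1) _ assms(2)] by (simp add: scaleR_add_left)
next
  case (step2 i)
  then show ?case
    using full_lattice_add[OF assms(1) _ full_lattice_minus[OF assms]] by (fastforce simp: scaleR_diff_left)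
qed

lemma linear_eq_on_lattice:
  fixes f g :: "'v::real_vector \<Rightarrow> real"
  assumes M: "full_lattice M" and "linear f" "linear g" and eq: "\<And>v. v \<in> M \<Longrightarrow> f v = g v"
  shows "f = g"
proof -
  obtain B where B: "finite B" "span B = UNIV"
    and M_eq: "M = range (\<lambda>c :: 'v \<Rightarrow> int. \<Sum>b\<in>B. of_int (c b) *\<^sub>R b)"
    using M unfolding full_lattice_def by blast
  have B_M: "b \<in> M" if "b \<in> B" for b
  proof -
    have "(\<Sum>x\<in>B. of_int (if x = b then 1 else 0) *\<^sub>R x) = (\<Sum>x\<in>B. if x = b then x else 0)"
      by (intro sum.cong) auto
    also have "\<dots> = b" using B(1) that by simp
    finally show ?thesis unfolding M_eq by (intro range_eqI[where x = "\<lambda>x. if x = b then 1 else 0"]) simp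
  qed
  show ?thesis
  proof
    fix x
    have "x \<in> span B" using B(2) by simp
    then show "f x = g x" by (rule linear_eq_on_span[OF assms(2,3), rotated]) (intro eq B_M)
  qed
qed

text \<open>Extend linearly from the basis \<open>B\<close> of the lattice. The error
  \<open>k\<close> is additive on \<open>M\<close> and vanishes on \<open>B\<close>, hence on all
  integral combinations.\<close>

lemma lattice_hom_extends:
  fixes h :: "'v::real_vector \<Rightarrow> real"
  assumes M: "full_lattice M" and h: "\<And>v w. v \<in> M \<Longrightarrow> w \<in> M \<Longrightarrow> h (v + w) = h v + h w"
  shows "\<exists>f. linear f \<and> (\<forall>v\<in>M. f v = h v)"
proof -
  obtain B where B: "finite B" "independent B"
    and M_eq: "M = range (\<lambda>c :: 'v \<Rightarrow> int. \<Sum>b\<in>B. of_int (c b) *\<^sub>R b)"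
    using M unfolding full_lattice_def by blast
  obtain f where f: "linear f" "\<forall>b\<in>B. f b = h b"
    using linear_independent_extend[OF B(2), of h] by blast
  define k where "k v = h v - f v" for v
  have k_add: "k (v + w) = k v + k w" if "v \<in> M" "w \<in> M" for v w
    unfolding k_def using h[OF that] by (simp add: linear_add[OF f(1)])
  have in_M: "(\<Sum>b\<in>S. of_int (c b) *\<^sub>R b) \<in> M" if "S \<subseteq> B" for S and c :: "'v \<Rightarrow> int"
  proof -
    have "(\<Sum>b\<in>S. of_int (c b) *\<^sub>R b) = (\<Sum>b\<in>B. of_int (if b \<in> S then c b else 0) *\<^sub>R b)"
      by (rule sum.mono_neutral_cong_left) (use B that in auto)
    then show ?thesis unfolding M_eq by (rule range_eqI[where x = "\<lambda>b. if b \<in> S then c b else 0"])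
  qed
  have B_M: "b \<in> M" if "b \<in> B" for b using in_M[of "{b}" "\<lambda>_. 1"] that by simp
  have k_0: "k 0 = 0" using k_add[of 0 0] full_lattice_zero[OF M] by simp
  have k_int: "k (of_int n *\<^sub>R b) = 0" if b: "b \<in> B" for n b
  proof (induction n rule: int_induct[where k = 0])
    case base
    then show ?case by (simp add: k_0)
  next
    case (step1 i)
    have "k (of_int i *\<^sub>R b + b) = k (of_int i *\<^sub>R b) + k b"
      by (intro k_add full_lattice_scale_int M B_M b)
    then show ?case using step1 f(2) b by (simp add: scaleR_add_left k_def)
  next
    case (step2 i)
    have "k (of_int (i - 1) *\<^sub>R b + b) = k (of_int (i - 1) *\<^sub>R b) + k b"
      by (intro k_add full_lattice_scale_int M B_M b)
    then show ?case using step2 f(2) b by (simp add: scaleR_diff_left k_def)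
  qed
  have "k (\<Sum>b\<in>S. of_int (c b) *\<^sub>R b) = 0" if "finite S" "S \<subseteq> B" for S and c :: "'v \<Rightarrow> int"
    using that
  proof (induction S rule: finite_induct)
    case (insert b S)
    have "k (of_int (c b) *\<^sub>R b + (\<Sum>b\<in>S. of_int (c b) *\<^sub>R b)) = 0 + 0"
      using insert k_int[of b "c b"] in_M[of S c] full_lattice_scale_int[OF M B_M, of b "c b"]
      by (subst k_add) auto
    then show ?case using insert.hyps by simp
  qed (simp add: k_0)
  then have "k v = 0" if "v \<in> M" for v using B(1) that unfolding M_eq by auto
  then have "\<forall>v\<in>M. f v = h v" unfolding k_def by simp
  with f(1) show ?thesis by blast
qed

lemma affine_automorphy_factor:
  fixes N \<Lambda> :: "'v::real_normed_vector set"
  assumes \<Lambda>: "full_lattice \<Lambda>"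
    and m: "\<And>v. v \<in> \<Lambda> \<Longrightarrow> m v \<in> dual_lattice N"
    and cocycle: "\<And>v w x. v \<in> \<Lambda> \<Longrightarrow> w \<in> \<Lambda> \<Longrightarrow>
      m (v + w) x + c (v + w) = (m v x + c v) + (m w (x + v) + c w)"
  shows "\<exists>E l. integral_form N \<Lambda> E \<and> linear l \<and> (\<forall>v\<in>\<Lambda>. \<forall>x. m v x + c v = factor E l v x)"
proof -
  have lin_m: "linear (m v)" if "v \<in> \<Lambda>" for v using m[OF that] by (rule dual_lattice_linear)
  \<comment> \<open>At \<open>x = 0\<close> only the constant terms and one value of
    \<open>m w\<close> survive; subtracting this relation from the general one makes
    \<open>m\<close> additive.\<close>
  have c_add: "c (v + w) = c v + c w + m w v" if "v \<in> \<Lambda>" "w \<in> \<Lambda>" for v w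
    using cocycle[OF that, of 0] that lin_m full_lattice_add[OF \<Lambda> that]
    by (simp add: linear_0)
  have m_add: "m (v + w) x = m v x + m w x" if "v \<in> \<Lambda>" "w \<in> \<Lambda>" for v w x
    using cocycle[OF that, of x] c_add[OF that] linear_add[OF lin_m[OF that(2)], of x v] by simp
  \<comment> \<open>The left side of \<open>c_add\<close> is symmetric in \<open>v\<close> and
    \<open>w\<close>, so its only asymmetric term must be symmetric too.\<close>
  have m_sym: "m v w = m w v" if "v \<in> \<Lambda>" "w \<in> \<Lambda>" for v w
    using c_add[OF that] c_add[OF that(2,1)] by (simp add: add.commute)
  \<comment> \<open>For fixed \<open>x\<close> the lattice variable is extended to the real space.
    Linearity in \<open>x\<close> then holds because both sides of each identity agree on the
    lattice.\<close>
  have "\<forall>x. \<exists>f. linear f \<and> (\<forall>v\<in>\<Lambda>. f v = - m v x)"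
    by (intro allI lattice_hom_extends[OF \<Lambda>]) (simp add: m_add)
  then obtain F where F: "\<And>x. linear (F x)" "\<And>x v. v \<in> \<Lambda> \<Longrightarrow> F x v = - m v x" by metis
  define E where "E v x = F x v" for v x
  have E_m: "E v x = - m v x" if "v \<in> \<Lambda>" for v x unfolding E_def by (rule F(2)[OF that])
  have lin1: "linear (\<lambda>v. E v x)" for x unfolding E_def by (rule F(1))
  have lin2: "linear (E v)" for v
  proof (rule linearI)
    fix x y
    have "F (x + y) = (\<lambda>v. F x v + F y v)"
      by (intro linear_eq_on_lattice[OF \<Lambda>] F linear_compose_add) (simp add: F(2) linear_add[OF lin_m])
    then show "E v (x + y) = E v x + E v y" unfolding E_def by simp
  next
    fix r x
    have "F (r *\<^sub>R x) = (\<lambda>v. r *\<^sub>R F x v)"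
      by (intro linear_eq_on_lattice[OF \<Lambda>] F linear_compose_scale_right) (simp add: F(2) linear_scale[OF lin_m])
    then show "E v (r *\<^sub>R x) = r *\<^sub>R E v x" unfolding E_def by simp
  qed
  have bil: "bilinear E" unfolding bilinear_def using lin1 lin2 by blast
  \<comment> \<open>Symmetry is extended from the lattice one argument at a time.\<close>
  have sym': "E x w = E w x" if w: "w \<in> \<Lambda>" for x w
  proof -
    have "(\<lambda>x. E x w) = E w"
      by (intro linear_eq_on_lattice[OF \<Lambda> lin1 lin2]) (simp add: E_m w m_sym)
    then show ?thesis by (rule fun_cong)
  qed
  have sym: "E x y = E y x" for x y
  proof -
    have "E x = (\<lambda>y. E y x)" by (intro linear_eq_on_lattice[OF \<Lambda> lin2 lin1] sym')
    then show ?thesis by (rule fun_cong)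
  qed
  have "E n v \<in> \<int>" if "n \<in> N" "v \<in> \<Lambda>" for n v
    using m[OF that(2)] that sym[of n v] by (auto simp: E_m dual_lattice_def)
  then have form: "integral_form N \<Lambda> E" unfolding integral_form_def using bil sym by blast
  \<comment> \<open>Half of the quadratic form has the polarization \<open>E w v\<close>, which
    cancels the defect \<open>m w v\<close> of additivity of \<open>c\<close>.\<close>
  have "\<exists>l. linear l \<and> (\<forall>v\<in>\<Lambda>. l v = c v + 1 / 2 * E v v)"
  proof (rule lattice_hom_extends[OF \<Lambda>])
    fix v w assume vw: "v \<in> \<Lambda>" "w \<in> \<Lambda>"
    have "E (v + w) (v + w) = E v v + E w w + 2 * E w v"
      using sym[of v w] by (simp add: bilinear_ladd[OF bil] bilinear_radd[OF bil])
    then show "c (v + w) + 1 / 2 * E (v + w) (v + w) = c v + 1 / 2 * E v v + (c w + 1 / 2 * E w w)"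
      using c_add[OF vw] E_m[OF vw(2), of v] by (simp add: field_simps)
  qed
  then obtain l where l: "linear l" "\<forall>v\<in>\<Lambda>. l v = c v + 1 / 2 * E v v" by blast
  have "m v x + c v = factor E l v x" if "v \<in> \<Lambda>" for v x
    unfolding factor_def using l(2) that E_m[OF that, of x] by simp
  then show ?thesis using form l(1) by blast
qed

section \<open>Isomorphisms onto quotient bundles\<close>

lemma atlas_trop_L: "atlas (trop_L \<Lambda> E l) = {(coset \<Lambda> ` W, fibre_coord W) | W. open W \<and> inj_on (coset \<Lambda>) W}"
  by (simp add: trop_L_def)

lemma proj_trop_L: "proj (trop_L \<Lambda> E l) = image fst"
  by (simp add: trop_L_def)

text \<open>For \<open>z\<close> near \<open>x\<close> the point \<open>z + v\<close> stays in the
  open set \<open>W\<close>, and injectivity makes it the only lift there. Local sections of the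
  covering are thus translations by a fixed lattice vector.\<close>

lemma inv_into_coset_near:
  assumes \<Lambda>: "full_lattice \<Lambda>" and W: "open W" "inj_on (coset \<Lambda>) W" and x: "coset \<Lambda> x \<in> coset \<Lambda> ` W"
  obtains v where "v \<in> \<Lambda>" "x + v \<in> W" "\<forall>\<^sub>F z in nhds x. inv_into W (coset \<Lambda>) (coset \<Lambda> z) = z + v"
proof -
  obtain w where w: "w \<in> W" "coset \<Lambda> x = coset \<Lambda> w" using x by blast
  define v where "v = w - x"
  have v: "v \<in> \<Lambda>" using w(2) unfolding v_def by (simp add: lattice_coset_eq_iff[OF \<Lambda>])
  have xv: "x + v \<in> W" using w(1) unfolding v_def by simp
  have "open ((\<lambda>z. z + v) -` W)" using W(1) by (intro open_vimage continuous_intros)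
  then have "\<forall>\<^sub>F z in nhds x. z \<in> (\<lambda>z. z + v) -` W" using xv by (intro eventually_nhds_in_open) auto
  then have "\<forall>\<^sub>F z in nhds x. inv_into W (coset \<Lambda>) (coset \<Lambda> z) = z + v"
  proof eventually_elim
    case (elim z)
    have "coset \<Lambda> z = coset \<Lambda> (z + v)" using v by (simp add: lattice_coset_eq_iff[OF \<Lambda>])
    then show ?case using inv_into_f_f[OF W(2), of "z + v"] elim by simp
  qed
  then show thesis using that v xv by blast
qed

text \<open>Here \<open>\<beta> x y\<close> is the coordinate of \<open>y\<close> with respect to a trivialization of the pullback
  of \<open>L\<close> to the universal cover, at the point \<open>x\<close> above the projection of \<open>y\<close>.\<close>

lemma tropical_isomorphic_trop_LI:
  assumes \<Lambda>: "full_lattice \<Lambda>" and E: "integral_form N \<Lambda> E" and l: "linear l"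
    and L: "tropical_line_bundle N \<Lambda> L"
    and \<beta>: "\<And>x y v. y \<in> topspace (tot L) \<Longrightarrow> proj L y = coset \<Lambda> x \<Longrightarrow> v \<in> \<Lambda> \<Longrightarrow>
        \<beta> (x + v) y = \<beta> x y + factor E l v x"
    and charts: "\<And>U t. (U, t) \<in> atlas L \<Longrightarrow> \<exists>g. \<forall>x. coset \<Lambda> x \<in> U \<longrightarrow> affine_near N g x \<and>
        (\<forall>y\<in>topspace (tot L). proj L y = coset \<Lambda> x \<longrightarrow> t y = \<beta> x y + g x)"
  shows "tropical_isomorphic N \<Lambda> L (trop_L \<Lambda> E l)"
proof -
  note move = orbit_move[OF \<Lambda> E l] and fibre = fibre_coord_orbit[OF \<Lambda> E l]
  define r where "r c = (SOME x. coset \<Lambda> x = c)" for c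
  have r: "coset \<Lambda> (r (coset \<Lambda> x)) = coset \<Lambda> x" for x unfolding r_def by (rule someI) (rule refl)
  define f where "f y = orbit \<Lambda> (factor E l) (r (proj L y), \<beta> (r (proj L y)) y)" for y
  \<comment> \<open>By assumption \<open>\<beta>\<close> changes under the lattice exactly as the
    second coordinate does under the action, so the orbit does not depend on the chosen
    representative.\<close>
  have f: "f y = orbit \<Lambda> (factor E l) (x, \<beta> x y)"
    if y: "y \<in> topspace (tot L)" "proj L y = coset \<Lambda> x" for x y
  proof -
    let ?r = "r (coset \<Lambda> x)"
    have "x - ?r \<in> \<Lambda>" using r[of x] by (simp add: lattice_coset_eq_iff[OF \<Lambda>])
    then have "\<beta> (?r + (x - ?r)) y = \<beta> ?r y + factor E l (x - ?r) ?r"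
      using y r by (intro \<beta>) auto
    then show ?thesis unfolding f_def y(2) move[OF r] by simp
  qed
  have "tropical_iso N \<Lambda> L (trop_L \<Lambda> E l) f"
  proof (rule tropical_isoI[OF \<Lambda> L tropical_line_bundle_trop_L[OF \<Lambda> E l]])
    fix y assume y: "y \<in> topspace (tot L)"
    show "f y \<in> topspace (tot (trop_L \<Lambda> E l))"
      unfolding f_def topspace_tot_trop_L[OF \<Lambda> E l] by blast
    obtain x where "proj L y = coset \<Lambda> x"
      using tropical_proj[OF L y] unfolding topspace_lattice_torus by blast
    then show "proj (trop_L \<Lambda> E l) (f y) = proj L y"
      using f[OF y] by (simp add: proj_trop_L fst_orbit[OF \<Lambda> E l])
  next
    fix U t U' t' assume U: "(U, t) \<in> atlas L" and "(U', t') \<in> atlas (trop_L \<Lambda> E l)"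
    then obtain W where W: "open W" "inj_on (coset \<Lambda>) W" and U': "U' = coset \<Lambda> ` W" "t' = fibre_coord W"
      unfolding atlas_trop_L by blast
    obtain g where g: "\<And>x. coset \<Lambda> x \<in> U \<Longrightarrow> affine_near N g x"
      "\<And>x y. coset \<Lambda> x \<in> U \<Longrightarrow> y \<in> topspace (tot L) \<Longrightarrow> proj L y = coset \<Lambda> x \<Longrightarrow> t y = \<beta> x y + g x"
      using charts[OF U] by blast
    define s where "s = inv_into W (coset \<Lambda>)"
    show "\<exists>\<phi>\<in>aff_sections N \<Lambda> (U \<inter> U'). \<forall>y\<in>over L (U \<inter> U'). t' (f y) = t y + \<phi> (proj L y)"
    proof (intro bexI ballI)
      fix y assume "y \<in> over L (U \<inter> U')"
      then have y: "y \<in> topspace (tot L)" "proj L y \<in> U" "proj L y \<in> coset \<Lambda> ` W"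
        using U' by (auto simp: over_def)
      have s: "s (proj L y) \<in> W" "coset \<Lambda> (s (proj L y)) = proj L y"
        unfolding s_def by (rule inv_into_into[OF y(3)]) (rule f_inv_into_f[OF y(3)])
      have "t' (f y) = \<beta> (s (proj L y)) y"
        unfolding U'(2) f[OF y(1) s(2)[symmetric]] by (rule fibre[OF W(2) s(1)])
      then show "t' (f y) = t y + - g (s (proj L y))"
        using g(2)[OF _ y(1) s(2)[symmetric]] s(2) y(2) by simp
    next
      \<comment> \<open>Near each point \<open>s\<close> is a lattice translation, so
        \<open>g\<close> composed with it is a translate of an affine germ of
        \<open>g\<close>.\<close>
      show "(\<lambda>c. - g (s c)) \<in> aff_sections N \<Lambda> (U \<inter> U')"
      proof (rule aff_sectionsI[OF \<Lambda>])
        show "openin (torus \<Lambda>) (U \<inter> U')"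
          unfolding U' by (intro openin_Int tropical_open[OF L U] lattice_openin_coset_image[OF \<Lambda> W(1)])
        fix x assume x: "coset \<Lambda> x \<in> U \<inter> U'"
        then obtain v where v: "v \<in> \<Lambda>" "\<forall>\<^sub>F z in nhds x. s (coset \<Lambda> z) = z + v"
          using inv_into_coset_near[OF \<Lambda> W, of x] unfolding U' s_def by blast
        have "coset \<Lambda> (x + v) = coset \<Lambda> x" using v(1)
          by (simp add: lattice_coset_eq_iff[OF \<Lambda>] full_lattice_minus[OF \<Lambda>])
        then have "affine_near N g (x + v)" using x by (intro g(1)) auto
        from affine_near_minus[OF affine_near_translate[OF this]]
        show "affine_near N (\<lambda>z. - g (s (coset \<Lambda> z))) x"
          by (rule affine_near_eventually_cong) (use v(2) in \<open>auto elim: eventually_mono\<close>)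
      qed
    qed
  qed
  then show ?thesis unfolding tropical_isomorphic_def by blast
qed

text \<open>A single point is not a chart, but the coset map is injective on it. So
  \<open>fibre_coord {x}\<close> reads the fibre coordinate over the lift \<open>x\<close>, which
  gives a global coordinate on the pullback to the universal cover.\<close>

lemma fibre_coord_singleton:
  fixes N \<Lambda> :: "'v::real_normed_vector set"
  assumes "full_lattice \<Lambda>" "integral_form N \<Lambda> E" "linear l"
  shows "fibre_coord {x} (orbit \<Lambda> (factor E l) (x, b)) = b"
  by (rule fibre_coord_orbit[OF assms]) auto

lemma trop_L_point:
  fixes N \<Lambda> :: "'v::real_normed_vector set"
  assumes \<Lambda>: "full_lattice \<Lambda>" and E: "integral_form N \<Lambda> E" and l: "linear l"
    and Q: "Q \<in> topspace (tot (trop_L \<Lambda> E l))" "fst ` Q = coset \<Lambda> x"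
  shows "Q = orbit \<Lambda> (factor E l) (x, fibre_coord {x} Q)"
proof -
  obtain w b where w: "Q = orbit \<Lambda> (factor E l) (w, b)"
    using Q(1) unfolding topspace_tot_trop_L[OF \<Lambda> E l] by auto
  then have "coset \<Lambda> w = coset \<Lambda> x" using Q(2) fst_orbit[OF \<Lambda> E l] by metis
  from orbit_move[OF \<Lambda> E l this, of b] obtain b' where b': "Q = orbit \<Lambda> (factor E l) (x, b')"
    unfolding w by blast
  then have "fibre_coord {x} Q = b'" using fibre_coord_singleton[OF \<Lambda> E l] by simp
  then show ?thesis using b' by simp
qed

lemma orbit_translate:
  fixes N \<Lambda> :: "'v::real_normed_vector set"
  assumes \<Lambda>: "full_lattice \<Lambda>" and E: "integral_form N \<Lambda> E" and l: "linear l" and "v \<in> \<Lambda>"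
  shows "orbit \<Lambda> (factor E l) (x, b) = orbit \<Lambda> (factor E l) (x + v, b + factor E l v x)"
  using orbit_move[OF \<Lambda> E l, of x "x + v" b] \<open>v \<in> \<Lambda>\<close> by (simp add: lattice_coset_eq_iff[OF \<Lambda>])

text \<open>Translating fibres by \<open>h\<close>, the difference of \<open>l'\<close> and
  \<open>l\<close>, adds \<open>h v\<close> to the automorphy factor and so turns \<open>l\<close>
  into \<open>l'\<close>. Integrality on \<open>N\<close> makes \<open>h\<close> an integral affine
  function.\<close>

lemma trop_L_isomorphic_if:
  assumes \<Lambda>: "full_lattice \<Lambda>" and E: "integral_form N \<Lambda> E" and l: "linear l" and l': "linear l'"
    and int: "\<forall>n\<in>N. l n - l' n \<in> \<int>"
  shows "tropical_isomorphic N \<Lambda> (trop_L \<Lambda> E l) (trop_L \<Lambda> E l')"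
proof -
  define h where "h x = l' x - l x" for x
  have lin_h: "linear h" unfolding h_def by (intro linear_compose_sub l l')
  have "- (l n - l' n) \<in> \<int>" if "n \<in> N" for n using int that by (intro Ints_minus) auto
  then have h: "h \<in> dual_lattice N" using lin_h by (auto simp: dual_lattice_def h_def)
  have coord: "fibre_coord {x + v} Q = fibre_coord {x} Q + factor E l v x"
    if "Q \<in> topspace (tot (trop_L \<Lambda> E l))" "proj (trop_L \<Lambda> E l) Q = coset \<Lambda> x" "v \<in> \<Lambda>" for Q x v
  proof -
    define b where "b = fibre_coord {x} Q"
    have "Q = orbit \<Lambda> (factor E l) (x, b)"
      unfolding b_def using that by (intro trop_L_point[OF \<Lambda> E l]) (simp_all add: proj_trop_L)
    then have "Q = orbit \<Lambda> (factor E l) (x + v, b + factor E l v x)"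
      using orbit_translate[OF \<Lambda> E l that(3)] by simp
    then show ?thesis unfolding b_def[symmetric] by (simp add: fibre_coord_singleton[OF \<Lambda> E l])
  qed
  show ?thesis
  proof (rule tropical_isomorphic_trop_LI[OF \<Lambda> E l' tropical_line_bundle_trop_L[OF \<Lambda> E l],
        where \<beta> = "\<lambda>x Q. fibre_coord {x} Q + h x"])
    fix x Q v
    assume "Q \<in> topspace (tot (trop_L \<Lambda> E l))" "proj (trop_L \<Lambda> E l) Q = coset \<Lambda> x" "v \<in> \<Lambda>"
    from coord[OF this] show "fibre_coord {x + v} Q + h (x + v) = fibre_coord {x} Q + h x + factor E l' v x"
      by (simp add: linear_add[OF lin_h] factor_def) (simp add: h_def)
  next
    fix U t assume "(U, t) \<in> atlas (trop_L \<Lambda> E l)"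
    then obtain W where W: "open W" "inj_on (coset \<Lambda>) W" and U: "U = coset \<Lambda> ` W" "t = fibre_coord W"
      unfolding atlas_trop_L by blast
    define s where "s = inv_into W (coset \<Lambda>)"
    \<comment> \<open>The first term passes from the coordinate over \<open>x\<close> to that over
      the lift in \<open>W\<close>; the second undoes the translation by \<open>h\<close>.\<close>
    define g where "g x = factor E l (s (coset \<Lambda> x) - x) x - h x" for x
    have "affine_near N g x \<and> (\<forall>Q\<in>topspace (tot (trop_L \<Lambda> E l)). proj (trop_L \<Lambda> E l) Q = coset \<Lambda> x \<longrightarrow>
        t Q = fibre_coord {x} Q + h x + g x)" if x: "coset \<Lambda> x \<in> U" for x
    proof (intro conjI ballI impI)
      obtain v where v: "v \<in> \<Lambda>" "\<forall>\<^sub>F z in nhds x. s (coset \<Lambda> z) = z + v"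
        using inv_into_coset_near[OF \<Lambda> W, of x] x unfolding U s_def by blast
      have "affine_near N (\<lambda>z. (- E v z + (l v - 1 / 2 * E v v)) - (h z + 0)) x"
        by (intro affine_near_diff affine_near_affine h factor_dual[OF \<Lambda> E l v(1)])
      then show "affine_near N g x"
        by (rule affine_near_eventually_cong)
           (use v(2) in \<open>auto simp: g_def factor_def elim!: eventually_mono\<close>)
      fix Q assume Q: "Q \<in> topspace (tot (trop_L \<Lambda> E l))" "proj (trop_L \<Lambda> E l) Q = coset \<Lambda> x"
      have s: "s (coset \<Lambda> x) \<in> W" "coset \<Lambda> (s (coset \<Lambda> x)) = coset \<Lambda> x"
        unfolding s_def using x inv_into_into[of "coset \<Lambda> x" "coset \<Lambda>" W]
          f_inv_into_f[of "coset \<Lambda> x" "coset \<Lambda>" W] by (simp_all add: U(1))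
      have "Q = orbit \<Lambda> (factor E l) (x, fibre_coord {x} Q)"
        using Q by (intro trop_L_point[OF \<Lambda> E l]) (simp_all add: proj_trop_L)
      also have "\<dots> = orbit \<Lambda> (factor E l) (s (coset \<Lambda> x),
          fibre_coord {x} Q + factor E l (s (coset \<Lambda> x) - x) x)"
        using s(2) by (intro orbit_move[OF \<Lambda> E l]) simp
      finally have "t Q = fibre_coord W \<dots>" unfolding U(2) by (rule arg_cong)
      also have "\<dots> = fibre_coord {x} Q + factor E l (s (coset \<Lambda> x) - x) x"
        by (rule fibre_coord_orbit[OF \<Lambda> E l W(2) s(1)])
      finally show "t Q = fibre_coord {x} Q + h x + g x" by (simp add: g_def)
    qed
    then show "\<exists>g. \<forall>x. coset \<Lambda> x \<in> U \<longrightarrow> affine_near N g x \<and>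
        (\<forall>Q\<in>topspace (tot (trop_L \<Lambda> E l)). proj (trop_L \<Lambda> E l) Q = coset \<Lambda> x \<longrightarrow>
          t Q = fibre_coord {x} Q + h x + g x)" by (intro exI[of _ g]) simp
  qed
qed

section \<open>Classification\<close>

text \<open>The isomorphism lifts to the universal cover as a translation of fibres by a locally
  affine function, which is globally affine by connectedness. Compatibility with both actions
  compares the factors.\<close>

lemma trop_L_isomorphic_only_if:
  assumes \<Lambda>: "full_lattice \<Lambda>" and E: "integral_form N \<Lambda> E" and l: "linear l"
    and E': "integral_form N \<Lambda> E'" and l': "linear l'"
    and iso: "tropical_isomorphic N \<Lambda> (trop_L \<Lambda> E l) (trop_L \<Lambda> E' l')"
  shows "E = E' \<and> (\<forall>n\<in>N. l n - l' n \<in> \<int>)"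
proof -
  let ?q = "orbit \<Lambda> (factor E l)" and ?q' = "orbit \<Lambda> (factor E' l')"
  obtain f where f: "homeomorphic_map (tot (trop_L \<Lambda> E l)) (tot (trop_L \<Lambda> E' l')) f"
    and pr: "\<forall>Q\<in>topspace (tot (trop_L \<Lambda> E l)). fst ` f Q = fst ` Q"
    and charts: "\<forall>(U, t)\<in>atlas (trop_L \<Lambda> E l). \<forall>(U', t')\<in>atlas (trop_L \<Lambda> E' l').
        \<exists>\<phi>\<in>aff_sections N \<Lambda> (U \<inter> U').
          \<forall>Q\<in>over (trop_L \<Lambda> E l) (U \<inter> U'). t' (f Q) = t Q + \<phi> (fst ` Q)"
    using iso unfolding tropical_isomorphic_def tropical_iso_def proj_trop_L by blast
  have q_top: "?q p \<in> topspace (tot (trop_L \<Lambda> E l))" for p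
    unfolding topspace_tot_trop_L[OF \<Lambda> E l] by blast
  then have f_top: "f (?q p) \<in> topspace (tot (trop_L \<Lambda> E' l'))" for p
    using homeomorphic_imp_surjective_map[OF f] by blast
  define k where "k x b = fibre_coord {x} (f (?q (x, b)))" for x b
  have f_k: "f (?q (x, b)) = ?q' (x, k x b)" for x b
    unfolding k_def using pr q_top f_top fst_orbit[OF \<Lambda> E l]
    by (intro trop_L_point[OF \<Lambda> E' l']) auto
  have local: "\<exists>W \<phi>. open W \<and> x \<in> W \<and> openin (torus \<Lambda>) (coset \<Lambda> ` W) \<and> \<phi> \<in> aff_sections N \<Lambda> (coset \<Lambda> ` W) \<and>
      (\<forall>z\<in>W. \<forall>b. k z b = b + \<phi> (coset \<Lambda> z))" for x
  proof -
    \<comment> \<open>The same \<open>W\<close> is used as a chart of both bundles, so that the two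
      lifts coincide.\<close>
    obtain W where W: "open W" "inj_on (coset \<Lambda>) W" "x \<in> W" using lattice_chart_cover[OF \<Lambda>] by blast
    have "(coset \<Lambda> ` W, fibre_coord W) \<in> atlas (trop_L \<Lambda> E l)"
      "(coset \<Lambda> ` W, fibre_coord W) \<in> atlas (trop_L \<Lambda> E' l')"
      unfolding atlas_trop_L using W by blast+
    then obtain \<phi> where \<phi>: "\<phi> \<in> aff_sections N \<Lambda> (coset \<Lambda> ` W)"
      and t: "\<And>Q. Q \<in> over (trop_L \<Lambda> E l) (coset \<Lambda> ` W) \<Longrightarrow>
        fibre_coord W (f Q) = fibre_coord W Q + \<phi> (fst ` Q)"
      using charts by fastforce
    have "k z b = b + \<phi> (coset \<Lambda> z)" if z: "z \<in> W" for z b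
    proof -
      have "?q (z, b) \<in> over (trop_L \<Lambda> E l) (coset \<Lambda> ` W)"
        unfolding over_trop_L[OF \<Lambda> E l] using z by blast
      from t[OF this] show ?thesis
        unfolding f_k fibre_coord_orbit[OF \<Lambda> E l W(2) z] fibre_coord_orbit[OF \<Lambda> E' l' W(2) z]
          fst_orbit[OF \<Lambda> E l] .
    qed
    then show ?thesis using W \<phi> lattice_openin_coset_image[OF \<Lambda> W(1)] by blast
  qed
  define h where "h x = k x 0" for x
  have k_h: "k x b = b + h x" for x b using local[of x] unfolding h_def by force
  have "affine_near N h x" for x
  proof -
    obtain W \<phi> where W: "open W" "x \<in> W" "openin (torus \<Lambda>) (coset \<Lambda> ` W)"
      and \<phi>: "\<phi> \<in> aff_sections N \<Lambda> (coset \<Lambda> ` W)" "\<forall>z\<in>W. \<forall>b. k z b = b + \<phi> (coset \<Lambda> z)"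
      using local[of x] by blast
    show ?thesis
      by (rule affine_near_cong_open[OF aff_sections_affine_near[OF \<phi>(1) W(3)] W(1,2)])
         (use W(2) \<phi>(2) in \<open>auto simp: h_def\<close>)
  qed
  then obtain m a where m: "m \<in> dual_lattice N" and h: "\<forall>x\<in>UNIV. h x = m x + a"
    using affine_near_imp_affine[OF connected_UNIV open_UNIV] by blast
  have key: "factor E l v x + m v = factor E' l' v x" if v: "v \<in> \<Lambda>" for v x
  proof -
    \<comment> \<open>The image of one orbit is computed from its representatives over
      \<open>x + v\<close> and over \<open>x\<close>.\<close>
    have "?q' (x + v, factor E l v x + h (x + v)) = f (?q (x, 0))"
      using f_k[of "x + v" "factor E l v x"] orbit_translate[OF \<Lambda> E l v, of x 0] k_h by simp
    also have "\<dots> = ?q' (x + v, h x + factor E' l' v x)"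
      using f_k[of x 0] orbit_translate[OF \<Lambda> E' l' v, of x "h x"] k_h by simp
    finally have "factor E l v x + h (x + v) = h x + factor E' l' v x"
      using fibre_coord_singleton[OF \<Lambda> E' l'] by metis
    then show ?thesis using h linear_add[OF dual_lattice_linear[OF m]] by simp
  qed
  \<comment> \<open>Subtracting the relation at \<open>0\<close> removes all terms that do not
    involve \<open>x\<close>.\<close>
  have E_eq: "E v x = E' v x" if v: "v \<in> \<Lambda>" for v x
    using key[OF v, of x] key[OF v, of 0] linear_0[OF form_linear[OF \<Lambda> E l]]
      linear_0[OF form_linear[OF \<Lambda> E' l']] unfolding factor_def by simp
  have "E v x = E' v x" for v x
  proof -
    have "E x = E' x"
      by (intro linear_eq_on_lattice[OF \<Lambda>] form_linear[OF \<Lambda> E l] form_linear[OF \<Lambda> E' l'])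
         (simp add: E_eq form_sym[OF \<Lambda> E l, of x] form_sym[OF \<Lambda> E' l', of x])
    then show ?thesis using form_sym[OF \<Lambda> E l, of v x] form_sym[OF \<Lambda> E' l', of v x] by simp
  qed
  then have "E = E'" by blast
  \<comment> \<open>Once the forms agree, the relation at \<open>0\<close> reduces to its linear
    terms on the lattice.\<close>
  moreover have "(\<lambda>x. l x + m x) = l'"
    using key[of _ 0] \<open>E = E'\<close>
    by (intro linear_eq_on_lattice[OF \<Lambda>] linear_compose_add l l' dual_lattice_linear[OF m])
       (simp add: factor_def)
  then have "l n - l' n = - m n" for n by auto
  then have "\<forall>n\<in>N. l n - l' n \<in> \<int>" using m by (auto simp: dual_lattice_def)
  ultimately show ?thesis by blast
qed

lemma tropical_line_bundle_is_trop_L: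
  fixes N \<Lambda> :: "'v::real_normed_vector set" and L :: "('v, 'y) torus_bundle"
  assumes \<Lambda>: "full_lattice \<Lambda>" and L: "tropical_line_bundle N \<Lambda> L"
  shows "\<exists>E l. integral_form N \<Lambda> E \<and> linear l \<and> tropical_isomorphic N \<Lambda> L (trop_L \<Lambda> E l)"
proof -
  let ?U = "\<lambda>i. {x. coset \<Lambda> x \<in> fst i}"
  have translate: "coset \<Lambda> (x + v) = coset \<Lambda> x" if "v \<in> \<Lambda>" for x v
    using that by (simp add: lattice_coset_eq_iff[OF \<Lambda>] full_lattice_minus[OF \<Lambda>])
  have cover: "\<exists>i\<in>atlas L. coset \<Lambda> x \<in> fst i" for x
    using tropical_cover[OF L, of "coset \<Lambda> x"] unfolding topspace_lattice_torus by force
  have "\<exists>y. y \<in> topspace (tot L) \<and> proj L y = coset \<Lambda> x" for x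
  proof -
    obtain U t where "(U, t) \<in> atlas L" "coset \<Lambda> x \<in> U" using cover[of x] by auto
    from tropical_chart_surj[OF L this] show ?thesis by (auto simp: over_def)
  qed
  then have "\<forall>c\<in>range (coset \<Lambda>). \<exists>y. y \<in> topspace (tot L) \<and> proj L y = c" by blast
  \<comment> \<open>An arbitrary set-theoretic section, used to read off transition functions; their
    independence of the point in the fibre is proved below.\<close>
  from bchoice[OF this] obtain \<sigma>
    where \<sigma>: "\<And>x. \<sigma> (coset \<Lambda> x) \<in> topspace (tot L)" "\<And>x. proj L (\<sigma> (coset \<Lambda> x)) = coset \<Lambda> x"
    by auto
  define \<phi> where "\<phi> i j x = snd j (\<sigma> (coset \<Lambda> x)) - snd i (\<sigma> (coset \<Lambda> x))"
    for i j :: "'v set set \<times> ('y \<Rightarrow> real)" and x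
  have trans: "\<exists>\<psi>\<in>aff_sections N \<Lambda> (fst i \<inter> fst j). \<forall>y\<in>over L (fst i \<inter> fst j). snd j y = snd i y + \<psi> (proj L y)"
    if "i \<in> atlas L" "j \<in> atlas L" for i j
    using tropical_transition[OF L, of "fst i" "snd i" "fst j" "snd j"] that by simp
  have \<phi>: "snd j y = snd i y + \<phi> i j x"
    if "i \<in> atlas L" "j \<in> atlas L" "coset \<Lambda> x \<in> fst i" "coset \<Lambda> x \<in> fst j"
      "y \<in> topspace (tot L)" "proj L y = coset \<Lambda> x" for i j x y
  proof -
    obtain \<psi> where \<psi>: "\<forall>y\<in>over L (fst i \<inter> fst j). snd j y = snd i y + \<psi> (proj L y)"
      using trans[OF \<open>i \<in> atlas L\<close> \<open>j \<in> atlas L\<close>] by blast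
    have "y \<in> over L (fst i \<inter> fst j)" "\<sigma> (coset \<Lambda> x) \<in> over L (fst i \<inter> fst j)"
      using that \<sigma>[of x] by (auto simp: over_def)
    then have "snd j y = snd i y + \<psi> (coset \<Lambda> x)"
      "snd j (\<sigma> (coset \<Lambda> x)) = snd i (\<sigma> (coset \<Lambda> x)) + \<psi> (coset \<Lambda> x)"
      using bspec[OF \<psi>] that(6) \<sigma>(2)[of x] by metis+
    then show ?thesis unfolding \<phi>_def by simp
  qed
  interpret affine_cocycle N "atlas L" ?U \<phi>
  proof
    fix i assume "i \<in> atlas L"
    then show "open (?U i)" using tropical_open[OF L, of "fst i" "snd i"] by (intro open_coset_vimage) simp
  next
    fix i j x assume i: "i \<in> atlas L" "j \<in> atlas L" "x \<in> ?U i" "x \<in> ?U j"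
    obtain \<psi> where \<psi>: "\<psi> \<in> aff_sections N \<Lambda> (fst i \<inter> fst j)"
      and eq: "\<forall>y\<in>over L (fst i \<inter> fst j). snd j y = snd i y + \<psi> (proj L y)"
      using trans[OF i(1,2)] by blast
    have op: "openin (torus \<Lambda>) (fst i \<inter> fst j)"
      using tropical_open[OF L, of "fst i" "snd i"] tropical_open[OF L, of "fst j" "snd j"] i(1,2)
      by (intro openin_Int) simp_all
    show "affine_near N (\<phi> i j) x"
    proof (rule affine_near_cong_open[OF aff_sections_affine_near[OF \<psi> op] open_coset_vimage[OF op]])
      fix z assume "z \<in> {x. coset \<Lambda> x \<in> fst i \<inter> fst j}"
      then have "\<sigma> (coset \<Lambda> z) \<in> over L (fst i \<inter> fst j)" using \<sigma> by (auto simp: over_def)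
      from bspec[OF eq this] show "\<phi> i j z = \<psi> (coset \<Lambda> z)" unfolding \<phi>_def \<sigma>(2) by simp
    qed (use i in auto)
  qed (use cover in \<open>auto simp: \<phi>_def\<close>)
  obtain g where g: "splits_on UNIV g" using splits_on_UNIV[OF \<Lambda>] by blast
  note g_diff = splits_onD[OF g UNIV_I] and g_aff = splits_on_affine[OF g UNIV_I]
  have "\<forall>c\<in>range (coset \<Lambda>). \<exists>i. i \<in> atlas L \<and> c \<in> fst i" using cover by blast
  \<comment> \<open>The chart is chosen per coset, so \<open>x\<close> and its lattice translates
    share it.\<close>
  from bchoice[OF this] obtain k where k: "\<And>x. k (coset \<Lambda> x) \<in> atlas L" "\<And>x. coset \<Lambda> x \<in> fst (k (coset \<Lambda> x))"
    by auto
  \<comment> \<open>Correcting a chart coordinate by the splitting yields a coordinate that no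
    longer depends on the chart: a trivialization of the pullback.\<close>
  define \<beta> where "\<beta> x y = snd (k (coset \<Lambda> x)) y - g (k (coset \<Lambda> x)) x" for x y
  have \<beta>: "snd i y = \<beta> x y + g i x"
    if "i \<in> atlas L" "coset \<Lambda> x \<in> fst i" "y \<in> topspace (tot L)" "proj L y = coset \<Lambda> x" for i x y
    using \<phi>[OF k(1)[of x] that(1) k(2) that(2,3,4)] g_diff[OF k(1)[of x] that(1), of x] k(2)[of x] that(2)
    unfolding \<beta>_def by simp
  define \<alpha> where "\<alpha> v x = g (k (coset \<Lambda> x)) x - g (k (coset \<Lambda> x)) (x + v)" for v x
  have \<alpha>: "\<alpha> v x = g i x - g i (x + v)" if "v \<in> \<Lambda>" "i \<in> atlas L" "coset \<Lambda> x \<in> fst i" for v x i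
  proof -
    \<comment> \<open>Transition functions come from the torus and are periodic, so they cancel in
      the difference that defines \<open>\<alpha>\<close>.\<close>
    have "\<phi> (k (coset \<Lambda> x)) i (x + v) = \<phi> (k (coset \<Lambda> x)) i x"
      unfolding \<phi>_def translate[OF that(1)] ..
    then show ?thesis
      using g_diff[OF k(1)[of x] that(2), of x] g_diff[OF k(1)[of x] that(2), of "x + v"]
        k(2)[of x] that translate[OF that(1), of x] unfolding \<alpha>_def by simp
  qed
  \<comment> \<open>The differences telescope; this is the cocycle condition required by
    \<open>affine_automorphy_factor\<close>.\<close>
  have \<alpha>_add: "\<alpha> (v + w) x = \<alpha> v x + \<alpha> w (x + v)" if "v \<in> \<Lambda>" "w \<in> \<Lambda>" for v w x
    unfolding \<alpha>_def translate[OF that(1)] by (simp add: add.assoc)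
  have "\<exists>m a. m \<in> dual_lattice N \<and> (\<forall>x. \<alpha> v x = m x + a)" if v: "v \<in> \<Lambda>" for v
  proof -
    have "affine_near N (\<alpha> v) x" for x
    proof -
      let ?i = "k (coset \<Lambda> x)"
      have "x + v \<in> ?U ?i" using k(2)[of x] translate[OF v, of x] by simp
      then have "affine_near N (\<lambda>z. g ?i z - g ?i (z + v)) x"
        by (intro affine_near_diff affine_near_translate g_aff k(1)) (use k(2)[of x] in simp_all)
      then show ?thesis
        by (rule affine_near_cong_open[OF _ open_U[OF k(1)[of x]]])
           (use k(2)[of x] \<alpha>[OF v k(1)[of x]] in simp_all)
    qed
    then show ?thesis using affine_near_imp_affine[OF connected_UNIV open_UNIV, of N "\<alpha> v"] by blast
  qed
  then obtain m c where m: "\<And>v. v \<in> \<Lambda> \<Longrightarrow> m v \<in> dual_lattice N"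
    and mc: "\<And>v x. v \<in> \<Lambda> \<Longrightarrow> \<alpha> v x = m v x + c v" by metis
  obtain E l where E: "integral_form N \<Lambda> E" and l: "linear l"
    and El: "\<forall>v\<in>\<Lambda>. \<forall>x. m v x + c v = factor E l v x"
    using affine_automorphy_factor[of \<Lambda> m N c, OF \<Lambda> m] mc \<alpha>_add full_lattice_add[OF \<Lambda>] by metis
  have "tropical_isomorphic N \<Lambda> L (trop_L \<Lambda> E l)"
  proof (rule tropical_isomorphic_trop_LI[OF \<Lambda> E l L, where \<beta> = \<beta>])
    fix x y v assume "y \<in> topspace (tot L)" "proj L y = coset \<Lambda> x" and v: "v \<in> \<Lambda>"
    have "\<beta> (x + v) y = \<beta> x y + \<alpha> v x" unfolding \<beta>_def \<alpha>_def translate[OF v] by simp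
    also have "\<alpha> v x = factor E l v x" using El mc v by simp
    finally show "\<beta> (x + v) y = \<beta> x y + factor E l v x" .
  next
    fix U t assume U: "(U, t) \<in> atlas L"
    show "\<exists>g. \<forall>x. coset \<Lambda> x \<in> U \<longrightarrow> affine_near N g x \<and>
        (\<forall>y\<in>topspace (tot L). proj L y = coset \<Lambda> x \<longrightarrow> t y = \<beta> x y + g x)"
      using g_aff[OF U] \<beta>[OF U] by (intro exI[of _ "g (U, t)"]) simp
  qed
  then show ?thesis using E l by blast
qed

theorem theoremC:
  fixes N \<Lambda> :: "'v::real_normed_vector set"
  assumes "full_lattice N" and "full_lattice \<Lambda>"
  shows "(\<forall>L :: ('v, 'y) torus_bundle. tropical_line_bundle N \<Lambda> L \<longrightarrow>
            (\<exists>E l. integral_form N \<Lambda> E \<and> linear l \<and>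
               tropical_isomorphic N \<Lambda> L (trop_L \<Lambda> E l))) \<and>
         (\<forall>E l E' l'. integral_form N \<Lambda> E \<and> linear l \<and> integral_form N \<Lambda> E' \<and> linear l' \<longrightarrow>
            (tropical_isomorphic N \<Lambda> (trop_L \<Lambda> E l) (trop_L \<Lambda> E' l') \<longleftrightarrow>
               E = E' \<and> (\<forall>n\<in>N. l n - l' n \<in> \<int>)))"
proof (intro conjI allI impI)
  fix L :: "('v, 'y) torus_bundle" assume "tropical_line_bundle N \<Lambda> L"
  then show "\<exists>E l. integral_form N \<Lambda> E \<and> linear l \<and> tropical_isomorphic N \<Lambda> L (trop_L \<Lambda> E l)"
    by (rule tropical_line_bundle_is_trop_L[OF assms(2)])
next
  fix E E' :: "'v \<Rightarrow> 'v \<Rightarrow> real" and l l' :: "'v \<Rightarrow> real"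
  assume *: "integral_form N \<Lambda> E \<and> linear l \<and> integral_form N \<Lambda> E' \<and> linear l'"
  then have "tropical_isomorphic N \<Lambda> (trop_L \<Lambda> E l) (trop_L \<Lambda> E l')" if "\<forall>n\<in>N. l n - l' n \<in> \<int>"
    using that by (intro trop_L_isomorphic_if[OF assms(2)]) simp_all
  moreover have "E = E' \<and> (\<forall>n\<in>N. l n - l' n \<in> \<int>)"
    if "tropical_isomorphic N \<Lambda> (trop_L \<Lambda> E l) (trop_L \<Lambda> E' l')"
    using * that by (intro trop_L_isomorphic_only_if[OF assms(2)]) simp_all
  ultimately show "tropical_isomorphic N \<Lambda> (trop_L \<Lambda> E l) (trop_L \<Lambda> E' l') \<longleftrightarrow>
      E = E' \<and> (\<forall>n\<in>N. l n - l' n \<in> \<int>)"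
    by blast
qed

end
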